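(* Let $J$ satisfy (A1)--(A3) and let $X$ be the Hunt process associated with $(\mathcal E,\mathcal F)$, with properly exceptional set $\mathcal N$ and lifetime $\zeta$ (as in the context). Then $X$ is conservative, i.e. $\mathbb P^x(\zeta=\infty)=1$ for every $x\in\mathbb R^d\setminus\mathcal N$.
   Context: Let $d\ge 1$ and let $J:\mathbb R^d\times\mathbb R^d\to[0,\infty)$ be measurable with: (A1) $J(x,y)=J(y,x)$ for all $x,y$; (A2) $J(x,y)=0$ for $|x-y|\ge 1$; (A3) there exist $0<\alpha<\beta<2$ and $\kappa_1,\kappa_2>0$ such that $\kappa_1|y-x|^{-d-\alpha}\le J(x,y)\le \kappa_2|y-x|^{-d-\beta}$ for $0<|x-y|<1$. Set $\mathcal E(f,f)=\int_{\mathbb R^d}\int_{\mathbb R^d}(f(y)-f(x))^2J(x,y)\,dx\,dy$, $\mathcal E_1(f,f)=\mathcal E(f,f)+\|f\|_2^2$, and let $\mathcal F$ be the closure of $C^1_c(\mathbb R^d)$ with respect to the norm $\mathcal E_1(f,f)^{1/2}$. Then $(\mathcal E,\mathcal F)$ is a regular symmetric Dirichlet form on $L^2(\mathbb R^d,dx)$; let $X$ be the associated Hunt process. It can start from every point outside a properly exceptional set $\mathcal N$, i.e. a set of zero capacity (hence zero Lebesgue measure) such that, started outside $\mathcal N$, $X$ and its left limits stay in $\mathbb R^d\setminus\mathcal N$ up to its lifetime $\zeta$. The set $\mathcal N$ is chosen so that $X$ has a symmetric transition density $p(t,x,y)$ with respect to Lebesgue measure, defined for $t>0$, $x,y\in\mathbb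 R^d\setminus\mathcal N$, which is quasi-continuous in $x$ and satisfies $p(t,x,y)\le C_1t^{-d/\alpha}e^{C_2t}$ for some constants $C_1,C_2>0$. *)

theory Defs
  imports "HOL-Probability.Probability"
begin

section \<open>The jump kernel and its quadratic form\<close>

definition jump_kernel ::
    "real \<Rightarrow> real \<Rightarrow> real \<Rightarrow> real \<Rightarrow> ('a::euclidean_space \<Rightarrow> 'a \<Rightarrow> real) \<Rightarrow> bool"
  where
  "jump_kernel \<alpha> \<beta> \<kappa>\<^sub>1 \<kappa>\<^sub>2 J \<longleftrightarrow>
     (\<lambda>(x, y). J x y) \<in> borel_measurable (borel \<Otimes>\<^sub>M borel) \<and>
     (\<forall>x y. 0 \<le> J x y) \<and>
     (\<forall>x y. J x y = J y x) \<and>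
     (\<forall>x y. 1 \<le> norm (x - y) \<longrightarrow> J x y = 0) \<and>
     0 < \<alpha> \<and> \<alpha> < \<beta> \<and> \<beta> < 2 \<and> 0 < \<kappa>\<^sub>1 \<and> 0 < \<kappa>\<^sub>2 \<and>
     (\<forall>x y. 0 < norm (x - y) \<and> norm (x - y) < 1 \<longrightarrow>
        \<kappa>\<^sub>1 * norm (y - x) powr (- real DIM('a) - \<alpha>) \<le> J x y \<and>
        J x y \<le> \<kappa>\<^sub>2 * norm (y - x) powr (- real DIM('a) - \<beta>))"

text \<open>Elements of $L^2$ are represented by Borel functions; operators and identities on $L^2$
  are accordingly stated almost everywhere.\<close>

definition L2 :: "('a::euclidean_space \<Rightarrow> real) set" where
  "L2 = {f \<in> borel_measurable lborel. integrable lborel (\<lambda>x. (f x)\<^sup>2)}"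

definition l2_inner :: "('a::euclidean_space \<Rightarrow> real) \<Rightarrow> ('a \<Rightarrow> real) \<Rightarrow> real" where
  "l2_inner f g = (LINT x|lborel. f x * g x)"

definition l2_norm :: "('a::euclidean_space \<Rightarrow> real) \<Rightarrow> real" where
  "l2_norm f = sqrt (l2_inner f f)"

text \<open>The quadratic form takes values in $[0,\infty]$, so that no spurious value arises for
  functions of infinite energy.\<close>

definition energy :: "('a::euclidean_space \<Rightarrow> 'a \<Rightarrow> real) \<Rightarrow> ('a \<Rightarrow> real) \<Rightarrow> ennreal" where
  "energy J f = (\<integral>\<^sup>+ y. (\<integral>\<^sup>+ x. ennreal ((f y - f x)\<^sup>2 * J x y) \<partial>lborel) \<partial>lborel)"

definition energy1 :: "('a::euclidean_space \<Rightarrow> 'a \<Rightarrow> real) \<Rightarrow> ('a \<Rightarrow> real) \<Rightarrow> ennreal" where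
  "energy1 J f = energy J f + (\<integral>\<^sup>+ x. ennreal ((f x)\<^sup>2) \<partial>lborel)"

definition C1_compact_support :: "('a::euclidean_space \<Rightarrow> real) set" where
  "C1_compact_support =
     {f. compact (closure {x. f x \<noteq> 0}) \<and>
         (\<exists>f'. (\<forall>x. (f has_derivative blinfun_apply (f' x)) (at x)) \<and> continuous_on UNIV f')}"

definition form_domain :: "('a::euclidean_space \<Rightarrow> 'a \<Rightarrow> real) \<Rightarrow> ('a \<Rightarrow> real) set" where
  "form_domain J =
     {f \<in> L2. \<forall>\<epsilon>>0. \<exists>g\<in>C1_compact_support. energy1 J (\<lambda>x. f x - g x) < \<epsilon>}"

text \<open>The bilinear form obtained from \<open>energy\<close> by polarization; the integrand is absolutely
  integrable for $f, g$ in the form domain.\<close>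

definition dirichlet_form ::
    "('a::euclidean_space \<Rightarrow> 'a \<Rightarrow> real) \<Rightarrow> ('a \<Rightarrow> real) \<Rightarrow> ('a \<Rightarrow> real) \<Rightarrow> real" where
  "dirichlet_form J f g =
     (LINT (x, y)|(lborel \<Otimes>\<^sub>M lborel). (f y - f x) * (g y - g x) * J x y)"

text \<open>The infimum over an empty family is $\infty$.\<close>

definition capacity :: "('a::euclidean_space \<Rightarrow> 'a \<Rightarrow> real) \<Rightarrow> 'a set \<Rightarrow> ennreal" where
  "capacity J A =
     Inf {energy1 J f | f U. open U \<and> A \<subseteq> U \<and> f \<in> form_domain J \<and>
                             (AE x in lborel. x \<in> U \<longrightarrow> 1 \<le> f x)}"

text \<open>Quasi-continuity of a function that is only considered off the exceptional set $N$.\<close>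

definition quasi_continuous_off ::
    "('a::euclidean_space \<Rightarrow> 'a \<Rightarrow> real) \<Rightarrow> 'a set \<Rightarrow> ('a \<Rightarrow> real) \<Rightarrow> bool" where
  "quasi_continuous_off J N f \<longleftrightarrow>
     (\<forall>\<epsilon>>0. \<exists>G. open G \<and> capacity J G < \<epsilon> \<and> continuous_on (- (N \<union> G)) f)"


section \<open>The semigroup of the Dirichlet form\<close>

locale l2_contraction_semigroup =
  fixes T :: "real \<Rightarrow> ('a::euclidean_space \<Rightarrow> real) \<Rightarrow> 'a \<Rightarrow> real"
  assumes in_L2: "0 \<le> t \<Longrightarrow> f \<in> L2 \<Longrightarrow> T t f \<in> L2"
    and linear: "0 \<le> t \<Longrightarrow> f \<in> L2 \<Longrightarrow> g \<in> L2 \<Longrightarrow>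
        AE x in lborel. T t (\<lambda>y. a * f y + b * g y) x = a * T t f x + b * T t g x"
    and symmetric: "0 \<le> t \<Longrightarrow> f \<in> L2 \<Longrightarrow> g \<in> L2 \<Longrightarrow> l2_inner (T t f) g = l2_inner f (T t g)"
    and contraction: "0 \<le> t \<Longrightarrow> f \<in> L2 \<Longrightarrow> l2_norm (T t f) \<le> l2_norm f"
    and zero: "f \<in> L2 \<Longrightarrow> AE x in lborel. T 0 f x = f x"
    and semigroup: "0 \<le> s \<Longrightarrow> 0 \<le> t \<Longrightarrow> f \<in> L2 \<Longrightarrow>
        AE x in lborel. T (s + t) f x = T s (T t f) x"
    and strongly_continuous: "f \<in> L2 \<Longrightarrow>
        ((\<lambda>t. l2_norm (\<lambda>x. T t f x - f x)) \<longlongrightarrow> 0) (at_right 0)"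

text \<open>$T$ is the semigroup of $(\mathcal{E},\mathcal{F})$: its resolvent
  $G_\gamma f = \int_0^\infty e^{-\gamma t} T_t f\,dt$ (a weak integral in $L^2$) is the resolvent
  of the form, i.e. $G_\gamma f \in \mathcal{F}$ and
  $\mathcal{E}(G_\gamma f, v) + \gamma (G_\gamma f, v) = (f, v)$ for all $v \in \mathcal{F}$.
  This determines $T$ up to null sets.\<close>

definition form_semigroup ::
    "('a::euclidean_space \<Rightarrow> 'a \<Rightarrow> real) \<Rightarrow> (real \<Rightarrow> ('a \<Rightarrow> real) \<Rightarrow> 'a \<Rightarrow> real) \<Rightarrow> bool" where
  "form_semigroup J T \<longleftrightarrow>
     l2_contraction_semigroup T \<and>
     (\<forall>\<gamma>>0. \<forall>f\<in>L2. \<exists>u\<in>form_domain J.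
        (\<forall>v\<in>L2. l2_inner u v = (LINT t:{0..}|lborel. exp (- \<gamma> * t) * l2_inner (T t f) v)) \<and>
        (\<forall>v\<in>form_domain J. dirichlet_form J u v + \<gamma> * l2_inner u v = l2_inner f v))"


section \<open>Hunt processes\<close>

text \<open>The cemetery point is \<open>None\<close>; it is the point at infinity of the one-point
  compactification of the state space.\<close>

abbreviation cemetery_top :: "'a::euclidean_space option topology" where
  "cemetery_top \<equiv> Alexandroff_compactification euclidean"

definition cemetery_borel :: "'a::euclidean_space option measure" where
  "cemetery_borel = sigma UNIV {U. openin cemetery_top U}"

abbreviation with_cemetery :: "'a set \<Rightarrow> 'a option set" where
  "with_cemetery S \<equiv> insert None (Some ` S)"

definition lifetime :: "(ennreal \<Rightarrow> 'w \<Rightarrow> 'a option) \<Rightarrow> 'w \<Rightarrow> ennreal" where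
  "lifetime X \<omega> = Inf {t. X t \<omega> = None}"

text \<open>A Hunt process that can be started from the points of $S$ and from the cemetery. Time runs
  through $[0,\infty]$, the time $\infty$ being part of the usual conventions. Only the starting
  points are restricted to $S$: that the paths do not leave $S$ is expressed separately, by
  \<open>properly_exceptional\<close> below. The simple Markov property is the strong one at constant
  times. The last two axioms are stated for deterministic starting points; they pass to general
  initial distributions by integration.\<close>

locale hunt_process = filtration "space \<Omega>" F
  for \<Omega> :: "'w measure" and F :: "ennreal \<Rightarrow> 'w measure" +
  fixes S :: "'a::euclidean_space set"
    and P :: "'a option \<Rightarrow> 'w measure"
    and X :: "ennreal \<Rightarrow> 'w \<Rightarrow> 'a option"
    and \<theta> :: "ennreal \<Rightarrow> 'w \<Rightarrow> 'w"
  assumes prob_space_P: "z \<in> with_cemetery S \<Longrightarrow> prob_space (P z)"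
    and sets_P: "z \<in> with_cemetery S \<Longrightarrow> sets (P z) = sets \<Omega>"
    and sets_F: "sets (F t) \<subseteq> sets \<Omega>"
    and adapted: "X t \<in> measurable (F t) cemetery_borel"
    and kernel_measurable: "E \<in> sets cemetery_borel \<Longrightarrow>
        (\<lambda>z. measure (P z) {\<omega> \<in> space \<Omega>. X t \<omega> \<in> E})
          \<in> borel_measurable (restrict_space cemetery_borel (with_cemetery S))"
    and normal: "z \<in> with_cemetery S \<Longrightarrow> AE \<omega> in P z. X 0 \<omega> = z"
    and at_infinity: "\<omega> \<in> space \<Omega> \<Longrightarrow> X \<infinity> \<omega> = None"
    and absorbed: "\<omega> \<in> space \<Omega> \<Longrightarrow> lifetime X \<omega> \<le> t \<Longrightarrow> X t \<omega> = None"
    and shift: "\<omega> \<in> space \<Omega> \<Longrightarrow> \<theta> t \<omega> \<in> space \<Omega> \<and> (\<forall>s. X s (\<theta> t \<omega>) = X (s + t) \<omega>)"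
    and right_continuous: "\<omega> \<in> space \<Omega> \<Longrightarrow> t < \<infinity> \<Longrightarrow>
        limitin cemetery_top (\<lambda>s. X s \<omega>) (X t \<omega>) (at_right t)"
    and left_limits: "\<omega> \<in> space \<Omega> \<Longrightarrow> 0 < t \<Longrightarrow> t < \<infinity> \<Longrightarrow>
        \<exists>z. limitin cemetery_top (\<lambda>s. X s \<omega>) z (at_left t)"
    and filtration_right_continuous: "t < \<infinity> \<Longrightarrow> sets (F t) = (\<Inter>s\<in>{t<..}. sets (F s))"
    and strong_markov: "z \<in> with_cemetery S \<Longrightarrow> stopping_time F \<sigma> \<Longrightarrow> E \<in> sets cemetery_borel \<Longrightarrow>
        AE \<omega> in P z.
          real_cond_exp (P z) (pre_sigma \<sigma>) (indicator {\<omega> \<in> space \<Omega>. X (\<sigma> \<omega> + s) \<omega> \<in> E}) \<omega>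
          = measure (P (X (\<sigma> \<omega>) \<omega>)) {\<omega>' \<in> space \<Omega>. X s \<omega>' \<in> E}"
    and quasi_left_continuous: "z \<in> with_cemetery S \<Longrightarrow> (\<And>n::nat. stopping_time F (\<tau> n)) \<Longrightarrow>
        (\<And>\<omega>. \<omega> \<in> space \<Omega> \<Longrightarrow> incseq (\<lambda>n. \<tau> n \<omega>)) \<Longrightarrow>
        AE \<omega> in P z. (SUP n. \<tau> n \<omega>) < \<infinity> \<longrightarrow>
          limitin cemetery_top (\<lambda>n. X (\<tau> n \<omega>) \<omega>) (X (SUP n. \<tau> n \<omega>) \<omega>) sequentially"

text \<open>The $L^2$ semigroup of the process is that of $(\mathcal{E},\mathcal{F})$; functions are
  extended by $0$ to the cemetery.\<close>

definition associated_process ::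
    "('a::euclidean_space \<Rightarrow> 'a \<Rightarrow> real) \<Rightarrow> 'a set \<Rightarrow> ('a option \<Rightarrow> 'w measure) \<Rightarrow>
     (ennreal \<Rightarrow> 'w \<Rightarrow> 'a option) \<Rightarrow> bool" where
  "associated_process J N P X \<longleftrightarrow>
     (\<exists>T. form_semigroup J T \<and>
        (\<forall>f\<in>L2. bounded (range f) \<longrightarrow>
           (\<forall>t>0. AE x in lborel. x \<notin> N \<longrightarrow>
              (LINT \<omega>|P (Some x). case_option 0 f (X (ennreal t) \<omega>)) = T t f x)))"

definition properly_exceptional ::
    "('a::euclidean_space \<Rightarrow> 'a \<Rightarrow> real) \<Rightarrow> 'a set \<Rightarrow> ('a option \<Rightarrow> 'w measure) \<Rightarrow>
     (ennreal \<Rightarrow> 'w \<Rightarrow> 'a option) \<Rightarrow> bool" where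
  "properly_exceptional J N P X \<longleftrightarrow>
     capacity J N = 0 \<and>
     (\<forall>x. x \<notin> N \<longrightarrow>
        (AE \<omega> in P (Some x). \<forall>t<lifetime X \<omega>.
           X t \<omega> \<in> Some ` (- N) \<and>
           (0 < t \<longrightarrow> (\<exists>z\<in>Some ` (- N). limitin cemetery_top (\<lambda>s. X s \<omega>) z (at_left t)))))"

text \<open>Since $N$ is a Lebesgue null set, the values of $p$ on $N$ do not affect the integral.\<close>

definition transition_density ::
    "'a::euclidean_space set \<Rightarrow> ('a option \<Rightarrow> 'w measure) \<Rightarrow> (ennreal \<Rightarrow> 'w \<Rightarrow> 'a option) \<Rightarrow>
     (real \<Rightarrow> 'a \<Rightarrow> 'a \<Rightarrow> real) \<Rightarrow> bool" where
  "transition_density N P X p \<longleftrightarrow>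
     (\<forall>t>0. \<forall>x. x \<notin> N \<longrightarrow>
        p t x \<in> borel_measurable (restrict_space borel (- N)) \<and>
        (\<forall>y. y \<notin> N \<longrightarrow> 0 \<le> p t x y) \<and>
        (\<forall>A\<in>sets borel.
           emeasure (P (Some x)) {\<omega> \<in> space (P (Some x)). X (ennreal t) \<omega> \<in> Some ` A}
           = (\<integral>\<^sup>+ y\<in>A. ennreal (p t x y) \<partial>lborel)))"

end

theory Submission
  imports Defs "HOL-Real_Asymp.Real_Asymp"
begin

text \<open>The process survives because the semigroup loses no mass, $T_t 1 = 1$, and this is a question
  about jumps far out: the kernel may be very singular on the diagonal and irregular elsewhere, but
  its second moments $\int |x-y|^2 J(x,y)\,dy$ are bounded by a constant $M$, as $\beta < 2$ and jumps
  are shorter than $1$.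

  The function $1$ is not in the form domain, and for $\beta \ge 1$ the generator cannot be applied to
  a smooth cutoff pointwise, so everything happens at the level of energies. Let $\phi_R$ be $C^1$
  cutoffs with Lipschitz constant $\delta = 4/R$ that tend to $1$, let
  $u = G_\gamma \phi_R$ be the resolvent and put $w = \phi_R - \gamma u$, the approximate mass lost
  before an independent exponential time. The resolvent equation tested with $v = w\eta$, where
  $\eta = e^{-\sqrt{1+|x|^2}}$, reads $\gamma \int w^2 \eta = \mathcal{E}(\phi_R - w, w\eta)$. Its part
  $\mathcal{E}(w, w\eta)$ is positive up to the variation of $\eta$, which over a jump is at
  most $2|x-y|\eta$; completing squares in the integrand gives
  $\gamma \int w^2\eta \le 2M\delta^2 \int\eta + 8M \int w^2\eta$ (\<open>weighted_resolvent_estimate\<close>).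
  With $\gamma = 8M+1$ the last term is absorbed and $w \to 0$ in $L^2(\eta\,dx)$ as $R \to \infty$.

  Hence $\gamma \int_0^\infty e^{-\gamma t} (T_t \phi_R, \eta)\,dt \to \int \eta$. The probability of
  being alive at time $t$ dominates $T_t\phi_R$, is at most $1$ and decreases in $t$; a deficit
  at one time would persist at all later times and keep this Laplace transform away from $\int\eta$
  (\<open>semigroup_conservative\<close>). So for each $t$ and almost every $x$ the process started in $x$ is
  alive at time $t$.

  To reach every $x \notin N$, run the process for a short time $s$. Its law at time $s$ has a density,
  so it sits at a point from which survival is certain, and the Markov property shows that the
  probability of being alive at time $t$ is at least that of being alive at time $s$. The latter
  tends to $1$ as $s \to 0$ by right-continuity of the paths (\<open>survival_eq_1\<close>).\<close>

section \<open>Integrals dominated on balls\<close>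

text \<open>Comparison of $f$ with the series $\sum_k a_k 1_{B(0,r_k)}$, which can be integrated term by term.\<close>
lemma nn_integral_finite_if_dominated_on_balls:
  fixes f :: "'a::euclidean_space \<Rightarrow> ennreal"
  assumes a: "\<And>k::nat. 0 \<le> a k" and r: "\<And>k. 0 \<le> r k"
    and le: "\<And>x. f x \<noteq> 0 \<Longrightarrow> \<exists>k. norm x < r k \<and> f x \<le> ennreal (a k)"
    and sum: "summable (\<lambda>k. a k * r k ^ DIM('a))"
  shows "(\<integral>\<^sup>+x. f x \<partial>lborel) < \<infinity>"
proof -
  let ?V = "unit_ball_vol (real DIM('a))"
  let ?g = "\<lambda>k x. ennreal (a k) * indicator (ball (0::'a) (r k)) x"
  have [simp]: "?g k \<in> borel_measurable borel" for k
    by (rule borel_measurable_times_ennreal[OF borel_measurable_const borel_measurable_indicator]) simp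
  have "f x \<le> (\<Sum>k. ?g k x)" for x
  proof (cases "f x = 0")
    case False
    then obtain k where k: "norm x < r k" "f x \<le> ennreal (a k)"
      using le by blast
    have "f x \<le> ?g k x"
      using k by simp
    also have "\<dots> = (\<Sum>i\<in>{k}. ?g i x)"
      by (simp only: sum.insert finite.emptyI sum.empty empty_iff not_False_eq_True add_0_right)
    also have "\<dots> \<le> (\<Sum>k. ?g k x)"
      by (intro sum_le_suminf) auto
    finally show ?thesis .
  qed simp
  then have "(\<integral>\<^sup>+x. f x \<partial>lborel) \<le> (\<integral>\<^sup>+x. (\<Sum>k. ?g k x) \<partial>lborel)"
    by (intro nn_integral_mono) auto
  also have "\<dots> = (\<Sum>k. \<integral>\<^sup>+x. ?g k x \<partial>lborel)"
    by (intro nn_integral_suminf) simp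
  also have "\<dots> = (\<Sum>k. ennreal (?V * (a k * r k ^ DIM('a))))"
  proof (rule suminf_cong)
    fix k
    have "(\<integral>\<^sup>+x. ?g k x \<partial>lborel) = ennreal (a k) * emeasure lborel (ball (0::'a) (r k))"
      by (rule nn_integral_cmult_indicator) simp
    also have "\<dots> = ennreal (a k * (?V * r k ^ DIM('a)))"
      unfolding emeasure_ball[OF r] by (rule ennreal_mult'[symmetric]) (rule a)
    finally show "(\<integral>\<^sup>+x. ?g k x \<partial>lborel) = ennreal (?V * (a k * r k ^ DIM('a)))"
      by (simp only: mult.left_commute)
  qed
  also have "\<dots> < \<infinity>"
    using a r sum
    by (subst suminf_ennreal2) (auto intro!: mult_nonneg_nonneg zero_le_power summable_mult unit_ball_vol_nonneg)
  finally show ?thesis .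
qed

text \<open>A dyadic decomposition of the ball: on the shell $2^{-k-1} \le |x| < 2^{-k}$ the integrand is
  comparable to $2^{-kp}$, so the series is geometric with ratio $2^{-(p+d)} < 1$.\<close>
lemma nn_integral_norm_powr_unit_ball_finite:
  assumes p: "- real DIM('a) < p"
  shows "(\<integral>\<^sup>+x. ennreal (norm x powr p) * indicator (ball 0 1) (x::'a::euclidean_space) \<partial>lborel) < \<infinity>"
proof (rule nn_integral_finite_if_dominated_on_balls)
  \<comment> \<open>The factor \<open>?C\<close> accounts for the sign of \<open>p\<close>: it decides at which end of a shell the integrand is largest.\<close>
  let ?C = "max 1 ((1/2) powr p)"
  let ?a = "\<lambda>k::nat. ?C * ((1/2) powr p) ^ k" and ?r = "\<lambda>k::nat. (1/2::real) ^ k"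
  show "0 \<le> ?a k" "0 \<le> ?r k" for k
    by auto
  show "summable (\<lambda>k. ?a k * ?r k ^ DIM('a))"
  proof -
    have "(1/2) powr p * (1/2) ^ DIM('a) = (1/2::real) powr (p + DIM('a))"
      by (simp add: powr_add powr_realpow)
    also have "\<dots> < (1/2) powr 0"
      using p by (intro powr_less_mono') auto
    finally have "summable (\<lambda>k. ((1/2) powr p * (1/2::real) ^ DIM('a)) ^ k)"
      by (intro summable_geometric) auto
    moreover have "?a k * ?r k ^ DIM('a) = ?C * ((1/2) powr p * (1/2::real) ^ DIM('a)) ^ k" for k
      by (simp add: power_mult_distrib mult.assoc power_mult[symmetric] mult.commute)
    ultimately show ?thesis
      by (simp only: summable_mult)
  qed
  show "\<exists>k. norm x < ?r k \<and> ennreal (norm x powr p) * indicator (ball 0 1) x \<le> ennreal (?a k)"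
    if "ennreal (norm x powr p) * indicator (ball 0 1) x \<noteq> 0" for x :: 'a
  proof -
    have x: "0 < norm x" "norm x < 1"
      using that by (auto split: split_indicator_asm)
    define k where "k = (LEAST k. ?r (Suc k) \<le> norm x)"
    have "\<exists>k. ?r k < norm x"
      using x by (intro real_arch_pow_inv) auto
    then have "\<exists>k. ?r (Suc k) \<le> norm x"
      using x by (metis less_imp_le not0_implies_Suc not_less power_0)
    then have k: "?r (Suc k) \<le> norm x"
      unfolding k_def by (rule LeastI_ex)
    have k': "norm x < ?r k"
    proof (cases k)
      case 0
      with x show ?thesis by simp
    next
      case (Suc j)
      then have "\<not> ?r (Suc j) \<le> norm x"
        unfolding k_def by (intro not_less_Least) (simp only: lessI)
      with Suc show ?thesis
        by (simp only: not_le)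
    qed
    have *: "?r k powr p = ((1/2) powr p) ^ k"
      by (metis powr_power powr_realpow zero_less_divide_1_iff zero_less_numeral mult.commute powr_powr powr_gt_zero)
    have "norm x powr p \<le> ?a k"
    proof (cases "0 \<le> p")
      case True
      have "norm x powr p \<le> ?r k powr p"
        using k' x True by (intro powr_mono2) auto
      also have "\<dots> \<le> ?a k"
        unfolding * using mult_right_mono[of 1 ?C "((1/2) powr p) ^ k"] by simp
      finally show ?thesis .
    next
      case False
      have "norm x powr p \<le> ?r (Suc k) powr p"
        using k x False by (intro powr_mono2') auto
      also have "\<dots> = (1/2) powr p * ((1/2) powr p) ^ k"
        by (subst *[symmetric]) (simp add: powr_mult[symmetric])
      also have "\<dots> \<le> ?a k"
        by (intro mult_right_mono) auto
      finally show ?thesis .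
    qed
    with k' show ?thesis
      by (intro exI[of _ k]) (auto split: split_indicator intro!: ennreal_leI)
  qed
qed

section \<open>The second moment of the jump kernel\<close>

lemma jump_kernelD:
  assumes "jump_kernel \<alpha> \<beta> \<kappa>\<^sub>1 \<kappa>\<^sub>2 (J :: 'a::euclidean_space \<Rightarrow> 'a \<Rightarrow> real)"
  shows "(\<lambda>(x, y). J x y) \<in> borel_measurable (borel \<Otimes>\<^sub>M borel)"
    and "0 \<le> J x y" and "J x y = J y x" and "1 \<le> norm (x - y) \<Longrightarrow> J x y = 0"
  using assms unfolding jump_kernel_def by auto

lemma nn_integral_lborel_translate:
  fixes f :: "'a::euclidean_space \<Rightarrow> ennreal"
  assumes [measurable]: "f \<in> borel_measurable borel"
  shows "(\<integral>\<^sup>+x. f (x - y) \<partial>lborel) = (\<integral>\<^sup>+x. f x \<partial>lborel)"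
proof -
  have "(\<integral>\<^sup>+x. f x \<partial>lborel) = (\<integral>\<^sup>+x. f x \<partial>distr lborel borel ((+) (- y)))"
    by (simp add: lborel_distr_plus)
  also have "\<dots> = (\<integral>\<^sup>+x. f (x - y) \<partial>lborel)"
    by (subst nn_integral_distr) (auto simp: add.commute)
  finally show ?thesis by simp
qed

text \<open>The squared distance turns the upper bound on \<open>J\<close> into $|z|^{2-d-\beta}$, whose exponent exceeds $-d$.\<close>
lemma jump_kernel_second_moment_bound:
  assumes J: "jump_kernel \<alpha> \<beta> \<kappa>\<^sub>1 \<kappa>\<^sub>2 (J :: 'a::euclidean_space \<Rightarrow> 'a \<Rightarrow> real)"
  obtains M where "0 \<le> M"
    "\<And>y. (\<integral>\<^sup>+x. ennreal ((norm (x - y))\<^sup>2 * J x y) \<partial>lborel) \<le> ennreal M"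
proof -
  let ?p = "2 - real DIM('a) - \<beta>"
  let ?f = "\<lambda>z::'a. ennreal \<kappa>\<^sub>2 * (ennreal (norm z powr ?p) * indicator (ball 0 1) z)"
  have [measurable]: "ball (0::'a) 1 \<in> sets borel"
    by simp
  have \<kappa>: "0 < \<kappa>\<^sub>2" and \<beta>: "\<beta> < 2"
    using J unfolding jump_kernel_def by auto
  have le: "ennreal ((norm (x - y))\<^sup>2 * J x y) \<le> ?f (x - y)" for x y
  proof (cases "0 < norm (x - y) \<and> norm (x - y) < 1")
    case True
    then have "J x y \<le> \<kappa>\<^sub>2 * norm (x - y) powr (- real DIM('a) - \<beta>)"
      using J unfolding jump_kernel_def by (metis norm_minus_commute)
    then have "(norm (x - y))\<^sup>2 * J x y \<le> (norm (x - y))\<^sup>2 * (\<kappa>\<^sub>2 * norm (x - y) powr (- real DIM('a) - \<beta>))"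
      by (intro mult_left_mono) auto
    also have "\<dots> = \<kappa>\<^sub>2 * (norm (x - y) powr 2 * norm (x - y) powr (- real DIM('a) - \<beta>))"
      using True by (simp add: mult_ac powr_numeral)
    also have "\<dots> = \<kappa>\<^sub>2 * norm (x - y) powr ?p"
      by (subst powr_add[symmetric]) (simp add: algebra_simps)
    finally show ?thesis
      using True \<kappa> by (simp add: ennreal_mult[symmetric] ennreal_leI dist_norm norm_minus_commute)
  next
    case False
    then have "(norm (x - y))\<^sup>2 * J x y = 0"
      using jump_kernelD(4)[OF J, of x y] by auto
    then show ?thesis by (simp only: ennreal_0 zero_le)
  qed
  have fin: "(\<integral>\<^sup>+z. ennreal (norm z powr ?p) * indicator (ball 0 1) (z::'a) \<partial>lborel) < top"
    unfolding infinity_ennreal_def[symmetric]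
    by (rule nn_integral_norm_powr_unit_ball_finite) (use \<beta> in linarith)
  have "(\<integral>\<^sup>+x. ?f x \<partial>lborel) = ennreal \<kappa>\<^sub>2 * (\<integral>\<^sup>+z. ennreal (norm z powr ?p) * indicator (ball 0 1) (z::'a) \<partial>lborel)"
    by (rule nn_integral_cmult) measurable
  also have "\<dots> < \<infinity>"
    unfolding infinity_ennreal_def by (rule ennreal_mult_less_top[THEN iffD2]) (simp only: fin ennreal_less_top simp_thms)
  finally have lt: "(\<integral>\<^sup>+x. ?f x \<partial>lborel) < top"
    unfolding infinity_ennreal_def .
  define M where "M = enn2real (\<integral>\<^sup>+x. ?f x \<partial>lborel)"
  have M: "0 \<le> M" "(\<integral>\<^sup>+x. ?f x \<partial>lborel) = ennreal M"
    unfolding M_def by (rule enn2real_nonneg) (rule ennreal_enn2real[OF lt, symmetric])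
  show thesis
  proof (rule that[OF M(1)])
    fix y
    have "(\<integral>\<^sup>+x. ennreal ((norm (x - y))\<^sup>2 * J x y) \<partial>lborel) \<le> (\<integral>\<^sup>+x. ?f (x - y) \<partial>lborel)"
      using le by (intro nn_integral_mono) auto
    also have "\<dots> = ennreal M"
      unfolding M(2)[symmetric] by (rule nn_integral_lborel_translate) measurable
    finally show "(\<integral>\<^sup>+x. ennreal ((norm (x - y))\<^sup>2 * J x y) \<partial>lborel) \<le> ennreal M" .
  qed
qed

section \<open>An exponential weight\<close>

text \<open>This is $e^{-\sqrt{1+|x|^2}}$. Writing the square root as the norm of $(1,x)$ makes its Lipschitz
  constant $1$ evident, while the function remains smooth at the origin.\<close>
definition weight :: "'a::euclidean_space \<Rightarrow> real" where
  "weight x = exp (- norm (1::real, x))"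

lemma weight_pos: "0 < weight x"
  by (simp add: weight_def)

lemma weight_le_1: "weight x \<le> 1"
  by (simp add: weight_def)

lemma measurable_weight[measurable, simp]: "weight \<in> borel_measurable borel"
  unfolding weight_def by (intro borel_measurable_continuous_onI continuous_intros)

lemma integrable_weight: "integrable lborel (weight :: 'a::euclidean_space \<Rightarrow> real)"
proof (rule integrableI_nonneg)
  show "(\<integral>\<^sup>+x. ennreal (weight (x::'a)) \<partial>lborel) < \<infinity>"
  proof (rule nn_integral_finite_if_dominated_on_balls)
    show "0 \<le> exp (- real k)" "0 \<le> real k + 1" for k
      by auto
    show "summable (\<lambda>k. exp (- real k) * (real k + 1) ^ DIM('a))"
    proof (rule summable_comparison_test_ev)
      have "eventually (\<lambda>k. exp (- real k) * (real k + 1) powr real DIM('a) \<le> inverse (real k ^ 2)) at_top"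
        by real_asymp
      then show "eventually (\<lambda>k. norm (exp (- real k) * (real k + 1) ^ DIM('a)) \<le> inverse (real k ^ 2)) at_top"
        by (rule eventually_mono) (simp add: powr_realpow add_pos_nonneg abs_mult)
      show "summable (\<lambda>k. inverse (real k ^ 2))"
        by (rule inverse_power_summable) auto
    qed
    show "\<exists>k. norm x < real k + 1 \<and> ennreal (weight x) \<le> ennreal (exp (- real k))" for x :: 'a
    proof (intro exI[of _ "nat \<lfloor>norm x\<rfloor>"] conjI ennreal_leI)
      show "norm x < real (nat \<lfloor>norm x\<rfloor>) + 1"
        by linarith
      have "norm x \<le> norm (1::real, x)"
        by (simp add: norm_Pair real_le_rsqrt)
      moreover have "real (nat \<lfloor>norm x\<rfloor>) \<le> norm x"
        by (rule of_nat_floor) (rule norm_ge_zero)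
      ultimately have "real (nat \<lfloor>norm x\<rfloor>) \<le> norm (1::real, x)"
        by linarith
      then show "weight x \<le> exp (- real (nat \<lfloor>norm x\<rfloor>))"
        unfolding weight_def by (simp only: exp_le_cancel_iff neg_le_iff_le)
    qed
  qed
  show "AE x in lborel. 0 \<le> weight (x::'a)"
    by (intro AE_I2 less_imp_le weight_pos)
  show "weight \<in> borel_measurable (lborel :: 'a measure)"
    by simp
qed

text \<open>The relative variation of the weight over a bounded jump is linear in the jump; this is what makes
  it possible to absorb the error terms that its variation produces. The weight at \<open>y\<close> is $e^d$ times
  that at \<open>x\<close>, with $|d| \le |x-y|$.\<close>
lemma weight_diff_le:
  fixes x y :: "'a::euclidean_space"
  assumes "norm (x - y) \<le> 1"
  shows "\<bar>weight x - weight y\<bar> \<le> 2 * norm (x - y) * weight x"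
proof -
  define d where "d = norm (1::real, x) - norm (1::real, y)"
  have "\<bar>d\<bar> \<le> norm ((1::real, x) - (1, y))"
    unfolding d_def by (rule norm_triangle_ineq3)
  then have d: "\<bar>d\<bar> \<le> norm (x - y)"
    by (simp add: norm_Pair)
  have "exp d - 1 \<le> 2 * norm (x - y)"
  proof -
    let ?r = "norm (x - y)"
    have "exp d \<le> exp ?r" using d by simp
    also have "\<dots> \<le> 1 + ?r + ?r\<^sup>2"
      using assms by (intro exp_bound) auto
    also have "?r\<^sup>2 \<le> ?r"
      using assms by (simp add: power2_eq_square mult_left_le)
    finally show ?thesis by simp
  qed
  moreover have "1 - exp d \<le> 2 * norm (x - y)"
    using exp_ge_add_one_self[of d] d norm_ge_zero[of "x - y"] by linarith
  ultimately have "\<bar>1 - exp d\<bar> \<le> 2 * norm (x - y)"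
    by linarith
  moreover have "weight x - weight y = weight x * (1 - exp d)"
    by (simp add: weight_def d_def algebra_simps flip: exp_add)
  ultimately show ?thesis
    using weight_pos[of x] by (simp add: abs_mult)
qed

section \<open>Square-integrable functions\<close>

lemma integrable_mult_L2:
  assumes "f \<in> L2" "g \<in> L2"
  shows "integrable lborel (\<lambda>x. f x * g x)"
proof (rule Bochner_Integration.integrable_bound)
  show "integrable lborel (\<lambda>x. (f x)\<^sup>2 + (g x)\<^sup>2)"
    using assms by (auto simp: L2_def)
  show "(\<lambda>x. f x * g x) \<in> borel_measurable lborel"
    using assms by (auto simp: L2_def)
  have "\<bar>a * b\<bar> \<le> a\<^sup>2 + b\<^sup>2" for a b :: real
    using sum_squares_bound[of "\<bar>a\<bar>" "\<bar>b\<bar>"] mult_nonneg_nonneg[of "\<bar>a\<bar>" "\<bar>b\<bar>"]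
    unfolding abs_mult power2_abs by linarith
  then show "AE x in lborel. norm (f x * g x) \<le> norm ((f x)\<^sup>2 + (g x)\<^sup>2)"
    by auto
qed

lemma L2_lincomb:
  assumes "f \<in> L2" "g \<in> L2"
  shows "(\<lambda>x. a * f x + b * g x) \<in> L2"
proof -
  have "integrable lborel (\<lambda>x. a\<^sup>2 * (f x)\<^sup>2 + b\<^sup>2 * (g x)\<^sup>2 + 2 * a * b * (f x * g x))"
    using assms integrable_mult_L2[OF assms] by (auto simp: L2_def)
  also have "(\<lambda>x. a\<^sup>2 * (f x)\<^sup>2 + b\<^sup>2 * (g x)\<^sup>2 + 2 * a * b * (f x * g x)) = (\<lambda>x. (a * f x + b * g x)\<^sup>2)"
    by (auto simp: power2_eq_square algebra_simps)
  finally show ?thesis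
    using assms by (auto simp: L2_def)
qed

lemma L2_mult_bounded:
  assumes "f \<in> L2" "h \<in> borel_measurable lborel" "\<And>x. \<bar>h x\<bar> \<le> 1"
  shows "(\<lambda>x. f x * h x) \<in> L2"
proof -
  have "integrable lborel (\<lambda>x. (f x * h x)\<^sup>2)"
  proof (rule Bochner_Integration.integrable_bound)
    show "integrable lborel (\<lambda>x. (f x)\<^sup>2)"
      using assms by (auto simp: L2_def)
    show "(\<lambda>x. (f x * h x)\<^sup>2) \<in> borel_measurable lborel"
      using assms by (auto simp: L2_def)
    have "(f x)\<^sup>2 * (h x)\<^sup>2 \<le> (f x)\<^sup>2" for x
      using assms(3)[of x] by (intro mult_left_le) (auto simp: abs_square_le_1)
    then show "AE x in lborel. norm ((f x * h x)\<^sup>2) \<le> norm ((f x)\<^sup>2)"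
      by (auto simp: power_mult_distrib)
  qed
  then show ?thesis
    using assms by (auto simp: L2_def)
qed

lemma weight_in_L2: "weight \<in> L2"
proof -
  have "integrable lborel (\<lambda>x::'a. (weight x)\<^sup>2)"
  proof (rule Bochner_Integration.integrable_bound[OF integrable_weight])
    have "(weight x)\<^sup>2 \<le> weight x" for x :: 'a
      using weight_pos[of x] weight_le_1[of x] by (simp add: power2_eq_square mult_left_le)
    then show "AE x in lborel. norm ((weight (x::'a))\<^sup>2) \<le> norm (weight x)"
      using weight_pos[where 'a='a] by (intro AE_I2) (simp add: less_imp_le)
  qed auto
  then show ?thesis
    by (auto simp: L2_def)
qed

lemma integrable_mult_weight:
  fixes h :: "'a::euclidean_space \<Rightarrow> real"
  assumes "h \<in> borel_measurable borel" "\<And>x. 0 \<le> h x" "\<And>x. h x \<le> 1"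
  shows "integrable lborel (\<lambda>x::'a. h x * weight x)"
proof (rule Bochner_Integration.integrable_bound[OF integrable_weight])
  show "(\<lambda>x. h x * weight x) \<in> borel_measurable lborel"
    using assms(1) by measurable
  have "h x * weight x \<le> 1 * weight x" for x
    using assms(3) weight_pos[of x] by (intro mult_right_mono) auto
  then show "AE x in lborel. norm (h x * weight x) \<le> norm (weight x)"
    using assms(2) weight_pos[where 'a='a] by (intro AE_I2) (simp add: abs_of_nonneg less_imp_le)
qed

section \<open>Continuously differentiable cutoffs\<close>

lemma C1_lincomb:
  assumes "f \<in> C1_compact_support" "g \<in> C1_compact_support"
  shows "(\<lambda>x. a * f x + b * g x) \<in> C1_compact_support"
proof -
  let ?h = "\<lambda>x. a * f x + b * g x"
  obtain f' where f': "\<And>x. (f has_derivative blinfun_apply (f' x)) (at x)" "continuous_on UNIV f'"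
    and f: "compact (closure {x. f x \<noteq> 0})"
    using assms(1) unfolding C1_compact_support_def by blast
  obtain g' where g': "\<And>x. (g has_derivative blinfun_apply (g' x)) (at x)" "continuous_on UNIV g'"
    and g: "compact (closure {x. g x \<noteq> 0})"
    using assms(2) unfolding C1_compact_support_def by blast
  have "(?h has_derivative blinfun_apply (a *\<^sub>R f' x + b *\<^sub>R g' x)) (at x)" for x
    by (auto intro!: derivative_eq_intros f' g' simp: blinfun.bilinear_simps)
  moreover have "continuous_on UNIV (\<lambda>x. a *\<^sub>R f' x + b *\<^sub>R g' x)"
    by (intro continuous_intros f' g')
  moreover have "{x. ?h x \<noteq> 0} \<subseteq> closure {x. f x \<noteq> 0} \<union> closure {x. g x \<noteq> 0}"
  proof
    fix x assume "x \<in> {x. ?h x \<noteq> 0}"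
    then have "f x \<noteq> 0 \<or> g x \<noteq> 0"
      by auto
    then show "x \<in> closure {x. f x \<noteq> 0} \<union> closure {x. g x \<noteq> 0}"
      using closure_subset[of "{x. f x \<noteq> 0}"] closure_subset[of "{x. g x \<noteq> 0}"] by blast
  qed
  then have "compact (closure {x. ?h x \<noteq> 0})"
    using compact_imp_bounded[OF compact_Un[OF f g]] bounded_subset compact_closure by blast
  ultimately show ?thesis
    unfolding C1_compact_support_def by (intro CollectI conjI exI) auto
qed

lemma C1_mult:
  assumes "f \<in> C1_compact_support"
    and g': "\<And>x. (g has_derivative blinfun_apply (g' x)) (at x)" "continuous_on UNIV g'"
  shows "(\<lambda>x. f x * g x) \<in> C1_compact_support"
proof -
  let ?h = "\<lambda>x. f x * g x"
  obtain f' where f': "\<And>x. (f has_derivative blinfun_apply (f' x)) (at x)" "continuous_on UNIV f'"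
    and f: "compact (closure {x. f x \<noteq> 0})"
    using assms(1) unfolding C1_compact_support_def by blast
  have "(?h has_derivative blinfun_apply (f x *\<^sub>R g' x + g x *\<^sub>R f' x)) (at x)" for x
    by (auto intro!: derivative_eq_intros f' g' simp: blinfun.bilinear_simps mult.commute)
  moreover have "continuous_on UNIV f" "continuous_on UNIV g"
    using f' g' by (auto intro!: has_derivative_continuous_on)
  then have "continuous_on UNIV (\<lambda>x. f x *\<^sub>R g' x + g x *\<^sub>R f' x)"
    by (intro continuous_intros f' g')
  moreover have "{x. ?h x \<noteq> 0} \<subseteq> closure {x. f x \<noteq> 0}"
    using closure_subset[of "{x. f x \<noteq> 0}"] by auto
  then have "compact (closure {x. ?h x \<noteq> 0})"
    using compact_imp_bounded[OF f] bounded_subset compact_closure by blast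
  ultimately show ?thesis
    unfolding C1_compact_support_def by (intro CollectI conjI exI) auto
qed

lemma weight_C1:
  obtains w' :: "'a::euclidean_space \<Rightarrow> 'a \<Rightarrow>\<^sub>L real"
  where "\<And>x. (weight has_derivative blinfun_apply (w' x)) (at x)" "continuous_on UNIV w'"
proof
  let ?w' = "\<lambda>x::'a. blinfun_inner_right ((- weight x / sqrt (1 + x \<bullet> x)) *\<^sub>R x)"
  have pos: "0 < 1 + x \<bullet> x" for x :: 'a
    by (simp add: add_pos_nonneg)
  have eq: "weight = (\<lambda>x::'a. exp (- sqrt (1 + x \<bullet> x)))"
    by (auto simp: weight_def norm_Pair power2_norm_eq_inner)
  show "(weight has_derivative blinfun_apply (?w' x)) (at x)" for x
    unfolding eq using pos[of x]
    by (auto intro!: derivative_eq_intros simp: inner_commute divide_simps)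
  have "continuous_on UNIV (weight :: 'a \<Rightarrow> real)"
    unfolding eq by (intro continuous_intros)
  then show "continuous_on UNIV ?w'"
    using pos by (intro continuous_intros bounded_linear.continuous_on[OF bounded_linear_blinfun_inner_right]) (auto simp: less_imp_neq[symmetric] dest: sym)
qed

text \<open>The outer square makes the function continuously differentiable on the sphere of radius \<open>R\<close>.\<close>
definition cutoff :: "real \<Rightarrow> 'a::euclidean_space \<Rightarrow> real" where
  "cutoff R x = (max 0 (1 - (norm x / R)\<^sup>2))\<^sup>2"

lemma cutoff_bounds: "0 \<le> cutoff R x" "cutoff R x \<le> 1"
  by (auto simp: cutoff_def power_le_one)

text \<open>The positive part is not differentiable at $0$, but its square is: the difference quotient at $0$
  is the positive part itself.\<close>
lemma has_derivative_max_0_square: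
  "((\<lambda>t::real. (max 0 t)\<^sup>2) has_real_derivative 2 * max 0 t) (at t)"
proof (cases "t = 0")
  case True
  have lim: "((\<lambda>h. max 0 h) \<longlongrightarrow> max 0 (0::real)) (at 0)"
    by (rule tendsto_max[OF tendsto_const tendsto_ident_at])
  have eq: "(\<lambda>h::real. ((max 0 (0 + h))\<^sup>2 - (max 0 0)\<^sup>2) / h) = (\<lambda>h. max 0 h)"
    by (rule ext) (simp add: max_def power2_eq_square)
  show ?thesis
    unfolding True DERIV_def eq using lim by simp
next
  case False
  show ?thesis
  proof (cases "0 < t")
    case True
    have "((\<lambda>t::real. t\<^sup>2) has_real_derivative 2 * max 0 t) (at t)"
      using True by (auto intro!: derivative_eq_intros)
    then show ?thesis
      by (rule has_field_derivative_transform_within_open[of _ _ _ "{0<..}"]) (use True in auto)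
  next
    case neg: False
    have "((\<lambda>t::real. 0) has_real_derivative 2 * max 0 t) (at t)"
      using neg by (auto intro!: derivative_eq_intros)
    then show ?thesis
      by (rule has_field_derivative_transform_within_open[of _ _ _ "{..<0}"]) (use neg False in auto)
  qed
qed

definition cutoff' :: "real \<Rightarrow> 'a::euclidean_space \<Rightarrow> 'a \<Rightarrow>\<^sub>L real" where
  "cutoff' R x = blinfun_inner_right ((- 4 * max 0 (1 - (norm x / R)\<^sup>2) / R\<^sup>2) *\<^sub>R x)"

lemma cutoff_has_derivative:
  "(cutoff R has_derivative blinfun_apply (cutoff' R x)) (at x)"
proof -
  define c where "c = 1 / R\<^sup>2"
  have eq: "cutoff R = (\<lambda>x::'a. (max 0 (1 - c * (x \<bullet> x)))\<^sup>2)"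
    by (auto simp: cutoff_def power_divide power2_norm_eq_inner c_def)
  have "((\<lambda>x::'a. 1 - c * (x \<bullet> x)) has_derivative (\<lambda>h. - (c * (2 * (x \<bullet> h))))) (at x)"
    by (auto intro!: derivative_eq_intros simp: inner_commute)
  from has_derivative_compose[OF this has_derivative_max_0_square[unfolded has_field_derivative_def]]
  show ?thesis
    unfolding eq cutoff'_def
    by (rule has_derivative_eq_rhs) (auto simp: fun_eq_iff power_divide power2_norm_eq_inner c_def)
qed

lemma continuous_on_cutoff': "continuous_on UNIV (cutoff' R)"
proof -
  define c where "c = 1 / R\<^sup>2"
  have eq: "cutoff' R = (\<lambda>x::'a. blinfun_inner_right ((- 4 * max 0 (1 - c * (norm x)\<^sup>2) * c) *\<^sub>R x))"
    by (auto simp: cutoff'_def c_def power_divide)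
  show ?thesis
    unfolding eq
    by (intro continuous_intros bounded_linear.continuous_on[OF bounded_linear_blinfun_inner_right])
qed

lemma norm_cutoff'_le:
  assumes R: "0 < R"
  shows "norm (cutoff' R x) \<le> 4 / R"
proof -
  have "max 0 (1 - (norm x / R)\<^sup>2) * norm x \<le> R"
  proof (cases "norm x \<le> R")
    case True
    have "max 0 (1 - (norm x / R)\<^sup>2) * norm x \<le> 1 * R"
      using True R by (intro mult_mono) auto
    then show ?thesis by simp
  next
    case False
    then have "1 \<le> (norm x / R)\<^sup>2"
      using R by (intro one_le_power) (simp add: field_simps)
    then show ?thesis using R by (simp add: max_def)
  qed
  then have "4 * (max 0 (1 - (norm x / R)\<^sup>2) * norm x) / R\<^sup>2 \<le> 4 * R / R\<^sup>2"
    by (intro divide_right_mono) auto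
  also have "\<dots> = 4 / R"
    using R by (simp add: power2_eq_square)
  finally have "norm ((- 4 * max 0 (1 - (norm x / R)\<^sup>2) / R\<^sup>2) *\<^sub>R x) \<le> 4 / R"
    by (simp add: abs_mult mult_ac)
  moreover have "norm (blinfun_inner_right v) \<le> norm v" for v :: 'a
    by (rule norm_blinfun_bound) (auto simp: Cauchy_Schwarz_ineq2)
  ultimately show ?thesis
    unfolding cutoff'_def by (meson order_trans)
qed

lemma cutoff_C1: "0 < R \<Longrightarrow> cutoff R \<in> C1_compact_support"
proof -
  assume R: "0 < R"
  have "{x::'a. cutoff R x \<noteq> 0} \<subseteq> cball 0 R"
  proof
    fix x :: 'a assume "x \<in> {x. cutoff R x \<noteq> 0}"
    then have "(norm x / R)\<^sup>2 \<le> 1" by (auto simp: cutoff_def max_def split: if_splits)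
    then have "norm x / R \<le> 1"
      using R by (simp add: abs_square_le_1)
    then show "x \<in> cball 0 R" using R by (simp add: field_simps)
  qed
  then have "compact (closure {x::'a. cutoff R x \<noteq> 0})"
    using bounded_cball bounded_subset compact_closure by blast
  then show ?thesis
    unfolding C1_compact_support_def using cutoff_has_derivative continuous_on_cutoff' by blast
qed

lemma cutoff_lipschitz:
  assumes R: "0 < R"
  shows "\<bar>cutoff R x - cutoff R y\<bar> \<le> 4 / R * norm (x - y)"
proof -
  have "norm (cutoff R x - cutoff R y) \<le> 4 / R * norm (x - y)"
  proof (rule differentiable_bound[of UNIV "cutoff R" "\<lambda>x. blinfun_apply (cutoff' R x)"])
    show "(cutoff R has_derivative blinfun_apply (cutoff' R x)) (at x within UNIV)" for x :: 'a
      by (rule cutoff_has_derivative)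
    show "onorm (blinfun_apply (cutoff' R x)) \<le> 4 / R" for x :: 'a
      using norm_cutoff'_le[OF R, of x] by (simp only: norm_blinfun.rep_eq)
  qed simp_all
  then show ?thesis
    by simp
qed

lemma measurable_cutoff[measurable]: "cutoff R \<in> borel_measurable borel"
  unfolding cutoff_def by measurable

lemma C1_in_L2:
  assumes "f \<in> C1_compact_support"
  shows "f \<in> L2"
proof -
  let ?K = "closure {x. f x \<noteq> 0}"
  obtain f' where K: "compact ?K" and f': "\<And>x. (f has_derivative blinfun_apply (f' x)) (at x)"
    using assms unfolding C1_compact_support_def by blast
  then have c: "continuous_on UNIV f"
    by (intro has_derivative_continuous_on) simp
  have "integrable lborel (\<lambda>x. indicator ?K x *\<^sub>R (f x)\<^sup>2)"
    using K by (intro borel_integrable_compact continuous_intros continuous_on_subset[OF c]) auto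
  also have "(\<lambda>x. indicator ?K x *\<^sub>R (f x)\<^sup>2) = (\<lambda>x. (f x)\<^sup>2)"
    using closure_subset[of "{x. f x \<noteq> 0}"] by (auto simp: fun_eq_iff indicator_def subset_iff)
  finally show ?thesis
    using c by (auto simp: L2_def borel_measurable_continuous_onI)
qed

lemma cutoff_tendsto_1: "((\<lambda>n. cutoff (real (Suc n)) x) \<longlonglongrightarrow> 1)"
proof -
  have "(\<lambda>n. (max 0 (1 - (norm x / real (Suc n))\<^sup>2))\<^sup>2) \<longlonglongrightarrow> (max 0 (1 - 0\<^sup>2))\<^sup>2"
    by (intro tendsto_intros LIMSEQ_Suc[OF lim_const_over_n])
  then show ?thesis
    unfolding cutoff_def by simp
qed

section \<open>Multiplication by the weight in the form domain\<close>

text \<open>All that the analytic part uses of the jump kernel: symmetry, range at most $1$ and second moments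
  bounded by \<open>M\<close>.\<close>
locale jump_kernel_second_moment =
  fixes J :: "'a::euclidean_space \<Rightarrow> 'a \<Rightarrow> real" and M :: real
  assumes J_borel: "(\<lambda>(x, y). J x y) \<in> borel_measurable (borel \<Otimes>\<^sub>M borel)"
    and J_nonneg: "0 \<le> J x y"
    and J_sym: "J x y = J y x"
    and J_range: "1 \<le> norm (x - y) \<Longrightarrow> J x y = 0"
    and M_nonneg: "0 \<le> M"
    and moment: "(\<integral>\<^sup>+x. ennreal ((norm (x - y))\<^sup>2 * J x y) \<partial>lborel) \<le> ennreal M"
begin

lemma J_measurable[measurable (raw)]:
  assumes "f \<in> borel_measurable N" "g \<in> borel_measurable N"
  shows "(\<lambda>z. J (f z) (g z)) \<in> borel_measurable N"
  using measurable_compose[OF measurable_Pair[OF assms] J_borel] by simp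

lemma moment':
  "(\<integral>\<^sup>+y. ennreal ((norm (x - y))\<^sup>2 * J x y) \<partial>lborel) \<le> ennreal M"
  using moment[of x] by (simp add: norm_minus_commute J_sym[of x])

text \<open>The errors in the energy estimate have this shape, and the order of integration can be
  chosen separately for the two summands so that the moment bound applies to the inner integral.\<close>
lemma nn_integral_moment_times_le:
  assumes [measurable]: "g \<in> borel_measurable borel" and g: "\<And>x. 0 \<le> g x"
  shows "(\<integral>\<^sup>+(x, y). ennreal ((norm (x - y))\<^sup>2 * J x y * (g x + g y)) \<partial>(lborel \<Otimes>\<^sub>M lborel))
         \<le> ennreal (2 * M) * (\<integral>\<^sup>+x. ennreal (g x) \<partial>lborel)"
proof -
  let ?m = "\<lambda>x y. ennreal ((norm (x - y))\<^sup>2 * J x y)"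
  let ?I = "\<integral>\<^sup>+x. ennreal (g x) \<partial>lborel"
  have meas: "(\<lambda>(x, y). ennreal (g x) * ?m x y) \<in> borel_measurable (lborel \<Otimes>\<^sub>M lborel)"
      "(\<lambda>(x, y). ennreal (g y) * ?m x y) \<in> borel_measurable (lborel \<Otimes>\<^sub>M lborel)"
    by measurable
  have "(\<integral>\<^sup>+(x, y). ennreal ((norm (x - y))\<^sup>2 * J x y * (g x + g y)) \<partial>(lborel \<Otimes>\<^sub>M lborel))
      = (\<integral>\<^sup>+z. (case z of (x, y) \<Rightarrow> ennreal (g x) * ?m x y) + (case z of (x, y) \<Rightarrow> ennreal (g y) * ?m x y) \<partial>(lborel \<Otimes>\<^sub>M lborel))"
    using g J_nonneg
    by (intro nn_integral_cong) (auto simp: ennreal_mult[symmetric] ennreal_plus[symmetric] algebra_simps simp del: ennreal_plus)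
  also have "\<dots> = (\<integral>\<^sup>+z. (case z of (x, y) \<Rightarrow> ennreal (g x) * ?m x y) \<partial>(lborel \<Otimes>\<^sub>M lborel))
      + (\<integral>\<^sup>+z. (case z of (x, y) \<Rightarrow> ennreal (g y) * ?m x y) \<partial>(lborel \<Otimes>\<^sub>M lborel))"
    by (rule nn_integral_add) measurable
  finally have split: "(\<integral>\<^sup>+(x, y). ennreal ((norm (x - y))\<^sup>2 * J x y * (g x + g y)) \<partial>(lborel \<Otimes>\<^sub>M lborel)) = \<dots>" .
  have "(\<integral>\<^sup>+z. (case z of (x, y) \<Rightarrow> ennreal (g x) * ?m x y) \<partial>(lborel \<Otimes>\<^sub>M lborel))
      = (\<integral>\<^sup>+x. \<integral>\<^sup>+y. ennreal (g x) * ?m x y \<partial>lborel \<partial>lborel)"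
    unfolding lborel.nn_integral_fst[OF meas(1), symmetric] by simp
  also have "\<dots> = (\<integral>\<^sup>+x. ennreal (g x) * (\<integral>\<^sup>+y. ?m x y \<partial>lborel) \<partial>lborel)"
    by (intro nn_integral_cong nn_integral_cmult) measurable
  also have "\<dots> \<le> (\<integral>\<^sup>+x. ennreal (g x) * ennreal M \<partial>lborel)"
    by (intro nn_integral_mono mult_left_mono moment') auto
  also have "\<dots> = ?I * ennreal M"
    by (rule nn_integral_multc) measurable
  finally have 1: "(\<integral>\<^sup>+z. (case z of (x, y) \<Rightarrow> ennreal (g x) * ?m x y) \<partial>(lborel \<Otimes>\<^sub>M lborel)) \<le> ?I * ennreal M" .
  have "(\<integral>\<^sup>+z. (case z of (x, y) \<Rightarrow> ennreal (g y) * ?m x y) \<partial>(lborel \<Otimes>\<^sub>M lborel))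
      = (\<integral>\<^sup>+y. \<integral>\<^sup>+x. ennreal (g y) * ?m x y \<partial>lborel \<partial>lborel)"
    unfolding lborel_pair.nn_integral_snd[OF meas(2), symmetric] by simp
  also have "\<dots> = (\<integral>\<^sup>+y. ennreal (g y) * (\<integral>\<^sup>+x. ?m x y \<partial>lborel) \<partial>lborel)"
    by (intro nn_integral_cong nn_integral_cmult) measurable
  also have "\<dots> \<le> (\<integral>\<^sup>+x. ennreal (g x) * ennreal M \<partial>lborel)"
    by (intro nn_integral_mono mult_left_mono moment) auto
  also have "\<dots> = ?I * ennreal M"
    by (rule nn_integral_multc) measurable
  finally have 2: "(\<integral>\<^sup>+z. (case z of (x, y) \<Rightarrow> ennreal (g y) * ?m x y) \<partial>(lborel \<Otimes>\<^sub>M lborel)) \<le> ?I * ennreal M" .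
  have "?I * ennreal M + ?I * ennreal M = ennreal (2 * M) * ?I"
    unfolding mult_2 ennreal_plus[OF M_nonneg M_nonneg] by (simp only: distrib_right mult.commute)
  with add_mono[OF 1 2] split show ?thesis
    by (simp only:)
qed

lemma weight_diff_sq_J_le:
  fixes x y :: 'a
  shows "(weight y - weight x)\<^sup>2 * J x y \<le> 4 * ((norm (x - y))\<^sup>2 * J x y)"
proof (cases "norm (x - y) \<le> 1")
  case True
  have "\<bar>weight y - weight x\<bar> \<le> 2 * norm (x - y) * weight x"
    using weight_diff_le[OF True] by (simp add: abs_minus_commute)
  also have "\<dots> \<le> 2 * norm (x - y)"
    using weight_le_1[of x] by (intro mult_left_le) auto
  finally have "\<bar>weight y - weight x\<bar> \<le> 2 * norm (x - y)" .
  from power_mono[OF this abs_ge_zero, of 2]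
  have "(weight y - weight x)\<^sup>2 \<le> (2 * norm (x - y))\<^sup>2"
    by (simp only: power2_abs)
  from mult_right_mono[OF this J_nonneg[of x y]] show ?thesis
    unfolding power_mult_distrib mult.assoc by simp
next
  case False
  then show ?thesis using J_range[of x y] by simp
qed

text \<open>By the product rule for differences,
  $\Delta(h\eta) = \eta(x)\,\Delta h + h(y)\,\Delta\eta$. Evaluating $h$ at \<open>y\<close> in the second
  term puts its square outside the inner integral of the energy, which runs over \<open>x\<close>.\<close>
lemma energy1_mult_weight_le:
  assumes [measurable]: "h \<in> borel_measurable borel"
  shows "energy1 J (\<lambda>x. h x * weight x) \<le> ennreal (3 + 8 * M) * energy1 J h"
proof -
  let ?I = "\<integral>\<^sup>+x. ennreal ((h x)\<^sup>2) \<partial>lborel"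
  have pt: "ennreal ((h y * weight y - h x * weight x)\<^sup>2 * J x y)
      \<le> 2 * ennreal ((h y - h x)\<^sup>2 * J x y) + ennreal (8 * (h y)\<^sup>2) * ennreal ((norm (x - y))\<^sup>2 * J x y)" for x y
  proof -
    let ?a = "weight x * (h y - h x)" and ?b = "h y * (weight y - weight x)"
    have "h y * weight y - h x * weight x = ?a + ?b"
      by (simp add: algebra_simps)
    then have "(h y * weight y - h x * weight x)\<^sup>2 * J x y \<le> (2 * ?a\<^sup>2 + 2 * ?b\<^sup>2) * J x y"
      using sum_squares_bound[of ?a ?b] by (intro mult_right_mono J_nonneg) (simp add: power2_sum)
    also have "\<dots> = 2 * ((weight x)\<^sup>2 * ((h y - h x)\<^sup>2 * J x y)) + 2 * (h y)\<^sup>2 * ((weight y - weight x)\<^sup>2 * J x y)"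
      unfolding power_mult_distrib by (simp add: algebra_simps)
    also have "\<dots> \<le> 2 * (1 * ((h y - h x)\<^sup>2 * J x y)) + 2 * (h y)\<^sup>2 * (4 * ((norm (x - y))\<^sup>2 * J x y))"
      using weight_pos[of x] weight_le_1[of x]
      by (intro add_mono mult_left_mono mult_right_mono weight_diff_sq_J_le mult_nonneg_nonneg J_nonneg)
        (auto simp: power_le_one)
    finally show ?thesis
      using J_nonneg[of x y]
      by (simp add: ennreal_mult[symmetric] ennreal_plus[symmetric] ennreal_leI mult_ac flip: ennreal_numeral del: ennreal_plus)
  qed
  have "energy J (\<lambda>x. h x * weight x)
      \<le> (\<integral>\<^sup>+y. \<integral>\<^sup>+x. 2 * ennreal ((h y - h x)\<^sup>2 * J x y) + ennreal (8 * (h y)\<^sup>2) * ennreal ((norm (x - y))\<^sup>2 * J x y) \<partial>lborel \<partial>lborel)"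
    unfolding energy_def by (intro nn_integral_mono pt)
  also have "\<dots> = (\<integral>\<^sup>+y. 2 * (\<integral>\<^sup>+x. ennreal ((h y - h x)\<^sup>2 * J x y) \<partial>lborel)
      + ennreal (8 * (h y)\<^sup>2) * (\<integral>\<^sup>+x. ennreal ((norm (x - y))\<^sup>2 * J x y) \<partial>lborel) \<partial>lborel)"
    by (simp add: nn_integral_add nn_integral_cmult)
  also have "\<dots> \<le> (\<integral>\<^sup>+y. 2 * (\<integral>\<^sup>+x. ennreal ((h y - h x)\<^sup>2 * J x y) \<partial>lborel)
      + ennreal (8 * M) * ennreal ((h y)\<^sup>2) \<partial>lborel)"
  proof (intro nn_integral_mono add_mono order_refl)
    fix y
    have "ennreal (8 * (h y)\<^sup>2) * (\<integral>\<^sup>+x. ennreal ((norm (x - y))\<^sup>2 * J x y) \<partial>lborel) \<le> ennreal (8 * (h y)\<^sup>2) * ennreal M"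
      by (intro mult_left_mono moment) auto
    also have "\<dots> = ennreal (8 * M) * ennreal ((h y)\<^sup>2)"
      using M_nonneg by (simp add: ennreal_mult[symmetric] mult_ac)
    finally show "ennreal (8 * (h y)\<^sup>2) * (\<integral>\<^sup>+x. ennreal ((norm (x - y))\<^sup>2 * J x y) \<partial>lborel) \<le> ennreal (8 * M) * ennreal ((h y)\<^sup>2)" .
  qed
  also have "\<dots> = 2 * energy J h + ennreal (8 * M) * ?I"
    unfolding energy_def by (simp add: nn_integral_add nn_integral_cmult)
  finally have 1: "energy J (\<lambda>x. h x * weight x) \<le> 2 * energy J h + ennreal (8 * M) * ?I" .
  have 2: "(\<integral>\<^sup>+x. ennreal ((h x * weight x)\<^sup>2) \<partial>lborel) \<le> ?I"
  proof (intro nn_integral_mono ennreal_leI)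
    fix x
    show "(h x * weight x)\<^sup>2 \<le> (h x)\<^sup>2"
      unfolding power_mult_distrib using weight_pos[of x] weight_le_1[of x]
      by (intro mult_left_le) (auto simp: power_le_one)
  qed
  have "energy1 J (\<lambda>x. h x * weight x) \<le> (2 * energy J h + ennreal (8 * M) * ?I) + ?I"
    unfolding energy1_def by (intro add_mono 1 2)
  also have "\<dots> \<le> ennreal (3 + 8 * M) * energy J h + ennreal (3 + 8 * M) * ?I"
  proof -
    have "2 * energy J h \<le> ennreal (3 + 8 * M) * energy J h"
    proof (rule mult_right_mono)
      have "ennreal 2 \<le> ennreal (3 + 8 * M)"
        using M_nonneg by (intro ennreal_leI) simp
      then show "2 \<le> ennreal (3 + 8 * M)"
        by (simp only: ennreal_numeral)
    qed simp
    moreover have "ennreal (8 * M) * ?I + ?I = ennreal (8 * M + 1) * ?I"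
      using M_nonneg by (simp add: distrib_right)
    moreover have "\<dots> \<le> ennreal (3 + 8 * M) * ?I"
      by (intro mult_right_mono ennreal_leI) auto
    ultimately show ?thesis
      by (simp add: add.assoc add_mono)
  qed
  finally show ?thesis
    by (simp add: energy1_def distrib_left)
qed

lemma energy1_cmult:
  assumes [measurable]: "h \<in> borel_measurable borel"
  shows "energy1 J (\<lambda>x. c * h x) = ennreal (c\<^sup>2) * energy1 J h"
proof -
  have *: "ennreal ((c * h y - c * h x)\<^sup>2 * J x y) = ennreal (c\<^sup>2) * ennreal ((h y - h x)\<^sup>2 * J x y)" for x y
    using J_nonneg[of x y]
    by (simp add: ennreal_mult[symmetric] right_diff_distrib[symmetric] power_mult_distrib mult.assoc)
  have **: "ennreal ((c * h x)\<^sup>2) = ennreal (c\<^sup>2) * ennreal ((h x)\<^sup>2)" for x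
    by (simp add: ennreal_mult[symmetric] power_mult_distrib)
  show ?thesis
    unfolding energy1_def energy_def * **
    by (simp add: nn_integral_cmult distrib_left)
qed

end

lemma jump_kernel_second_momentI:
  assumes J: "jump_kernel \<alpha> \<beta> \<kappa>\<^sub>1 \<kappa>\<^sub>2 (J :: 'a::euclidean_space \<Rightarrow> 'a \<Rightarrow> real)"
  obtains M where "jump_kernel_second_moment J M"
proof -
  obtain M where M: "0 \<le> M"
    "\<And>y. (\<integral>\<^sup>+x. ennreal ((norm (x - y))\<^sup>2 * J x y) \<partial>lborel) \<le> ennreal M"
    using jump_kernel_second_moment_bound[OF J] by blast
  have "jump_kernel_second_moment J M"
    using jump_kernelD[OF J] M by unfold_locales
  then show thesis by (rule that)
qed

context jump_kernel_second_moment
begin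

text \<open>If $g$ approximates \<open>u\<close> in energy, then $(\phi - cg)\eta$ is an admissible $C^1$ approximation, since
  multiplication by the weight is bounded in energy.\<close>
lemma weighted_combination_in_form_domain:
  assumes u: "u \<in> form_domain J" and \<phi>: "\<phi> \<in> C1_compact_support"
  shows "(\<lambda>x. (\<phi> x - c * u x) * weight x) \<in> form_domain J"
  unfolding form_domain_def
proof (intro CollectI conjI allI impI)
  have uL: "u \<in> L2" and approx: "\<And>\<epsilon>. 0 < \<epsilon> \<Longrightarrow> \<exists>g\<in>C1_compact_support. energy1 J (\<lambda>x. u x - g x) < \<epsilon>"
    using u by (auto simp: form_domain_def)
  have [measurable]: "u \<in> borel_measurable borel"
    using uL by (simp add: L2_def)
  have "(\<lambda>x. 1 * \<phi> x + (- c) * u x) \<in> L2"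
    by (intro L2_lincomb C1_in_L2 \<phi> uL)
  then have "(\<lambda>x. \<phi> x - c * u x) \<in> L2"
    by simp
  then show "(\<lambda>x. (\<phi> x - c * u x) * weight x) \<in> L2"
    using weight_pos[where 'a='a] weight_le_1[where 'a='a]
    by (intro L2_mult_bounded) (auto simp: less_imp_le)
  fix \<epsilon> :: ennreal assume "0 < \<epsilon>"
  then obtain e :: real where e: "0 < e" "ennreal e \<le> \<epsilon>"
  proof (cases \<epsilon>)
    case (real r)
    then show ?thesis using that[of r] \<open>0 < \<epsilon>\<close> by auto
  next
    case top
    then show ?thesis using that[of 1] by auto
  qed
  \<comment> \<open>The summand 1 keeps \<open>K\<close> positive when \<open>c = 0\<close>.\<close>
  define K where "K = (3 + 8 * M) * (c\<^sup>2 + 1)"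
  have K: "0 < K"
    using M_nonneg unfolding K_def by (intro mult_pos_pos add_pos_nonneg add_nonneg_pos) auto
  have "0 < ennreal (e / K)"
    using e(1) K by simp
  then obtain g where g: "g \<in> C1_compact_support" and lt: "energy1 J (\<lambda>x. u x - g x) < ennreal (e / K)"
    using approx by blast
  have [measurable]: "g \<in> borel_measurable borel"
    using C1_in_L2[OF g] by (simp add: L2_def)
  obtain w' :: "'a \<Rightarrow> 'a \<Rightarrow>\<^sub>L real" where w': "\<And>x. (weight has_derivative blinfun_apply (w' x)) (at x)" "continuous_on UNIV w'"
    using weight_C1 by blast
  have "(\<lambda>x. 1 * \<phi> x + (- c) * g x) \<in> C1_compact_support"
    by (intro C1_lincomb \<phi> g)
  then have gw: "(\<lambda>x. (\<phi> x - c * g x) * weight x) \<in> C1_compact_support"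
    using C1_mult[OF _ w', of "\<lambda>x. \<phi> x - c * g x"] by simp
  have "energy1 J (\<lambda>x. (\<phi> x - c * u x) * weight x - (\<phi> x - c * g x) * weight x)
      = energy1 J (\<lambda>x. ((- c) * (u x - g x)) * weight x)"
    by (simp add: algebra_simps)
  also have "\<dots> \<le> ennreal (3 + 8 * M) * energy1 J (\<lambda>x. (- c) * (u x - g x))"
    by (rule energy1_mult_weight_le) measurable
  also have "energy1 J (\<lambda>x. (- c) * (u x - g x)) = ennreal ((- c)\<^sup>2) * energy1 J (\<lambda>x. u x - g x)"
    by (rule energy1_cmult) measurable
  also have "ennreal (3 + 8 * M) * (ennreal ((- c)\<^sup>2) * energy1 J (\<lambda>x. u x - g x))
      \<le> ennreal (3 + 8 * M) * (ennreal (c\<^sup>2 + 1) * energy1 J (\<lambda>x. u x - g x))"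
    by (intro mult_left_mono mult_right_mono ennreal_leI) auto
  also have "\<dots> = ennreal K * energy1 J (\<lambda>x. u x - g x)"
  proof -
    have "ennreal K = ennreal (3 + 8 * M) * ennreal (c\<^sup>2 + 1)"
      unfolding K_def using M_nonneg by (intro ennreal_mult) auto
    then show ?thesis
      by (simp only: mult.assoc)
  qed
  also have "\<dots> < ennreal K * ennreal (e / K)"
    using K lt by (intro ennreal_mult_strict_left_mono) auto
  also have "\<dots> = ennreal e"
    using K e(1) by (simp add: ennreal_mult[symmetric])
  also note e(2)
  finally show "\<exists>g\<in>C1_compact_support. energy1 J (\<lambda>x. (\<phi> x - c * u x) * weight x - g x) < \<epsilon>"
    by (intro bexI[OF _ gw])
qed

end

section \<open>The weighted resolvent estimate\<close>

text \<open>The algebra behind the energy estimate. Here \<open>a\<close>, \<open>c\<close>, \<open>b\<close> stand for the increments of $w$, the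
  cutoff and the weight over a jump of length \<open>r\<close>, and \<open>A\<close>, \<open>W\<close> for the means of the weight and of
  $w$ at its ends, so that \<open>a * A + W * b\<close> is the increment of $w\eta$. The term $-a^2 A$ on the left
  absorbs every occurrence of \<open>a\<close>; nothing is known about the size of \<open>a\<close>.\<close>
lemma weighted_energy_pointwise:
  fixes a b c A W m r :: real
  assumes "0 < A" "0 \<le> m" "m \<le> A" "\<bar>b\<bar> \<le> 2 * r * m"
  shows "(c - a) * (a * A + W * b) \<le> 2 * c\<^sup>2 * A + 8 * W\<^sup>2 * r\<^sup>2 * m"
proof -
  define p q s where "p = a * A" and "q = W * b" and "s = c * A"
  \<comment> \<open>After multiplication by \<open>A\<close> the claim concerns a quadratic form in \<open>p\<close>, \<open>q\<close>, \<open>s\<close>, written here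
    as a sum of squares.\<close>
  have "0 \<le> (p + (q - s) / 2)\<^sup>2 + 3 / 2 * (s\<^sup>2 + q\<^sup>2) + (s - q)\<^sup>2 / 4"
    by simp
  also have "\<dots> = 2 * s\<^sup>2 + 2 * q\<^sup>2 - (s - p) * (p + q)"
    by (simp add: power2_eq_square field_simps)
  finally have "(s - p) * (p + q) \<le> 2 * s\<^sup>2 + 2 * q\<^sup>2"
    by simp
  then have 1: "A * ((c - a) * (a * A + W * b)) \<le> 2 * c\<^sup>2 * A\<^sup>2 + 2 * (W\<^sup>2 * b\<^sup>2)"
    by (simp add: p_def q_def s_def algebra_simps power2_eq_square)
  have "b\<^sup>2 \<le> (2 * r * m)\<^sup>2"
    using assms(4) by (simp add: abs_le_square_iff[symmetric])
  also have "\<dots> = 4 * r\<^sup>2 * m * m"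
    by (simp add: power2_eq_square)
  also have "\<dots> \<le> 4 * r\<^sup>2 * m * A"
    using assms by (intro mult_left_mono) auto
  finally have "W\<^sup>2 * b\<^sup>2 \<le> W\<^sup>2 * (4 * r\<^sup>2 * m * A)"
    by (rule mult_left_mono) simp
  with 1 have "A * ((c - a) * (a * A + W * b)) \<le> A * (2 * c\<^sup>2 * A + 8 * W\<^sup>2 * r\<^sup>2 * m)"
    by (simp add: algebra_simps power2_eq_square)
  then show ?thesis
    using assms(1) by (simp only: mult_le_cancel_left_pos)
qed

context jump_kernel_second_moment
begin

text \<open>The function $\phi - \gamma u$ is tested against the resolvent equation in the form
  $\gamma\,\mathcal{E}(u, w\eta) = \gamma \int w^2 \eta$. The integrand of the left side is
  bounded from above pointwise by an integrable function, and the second moment bound turns this into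
  $2M(\delta^2\int\eta + 4\int w^2\eta)$. The choice of \<open>\<gamma>\<close> leaves exactly one copy of
  $\int w^2\eta$ after absorption.\<close>
lemma weighted_resolvent_estimate:
  assumes \<gamma>: "\<gamma> = 8 * M + 1"
    and u: "u \<in> form_domain J" and \<phi>: "\<phi> \<in> C1_compact_support"
    and lip: "\<And>x y. \<bar>\<phi> x - \<phi> y\<bar> \<le> \<delta> * norm (x - y)"
    and eq: "\<And>v. v \<in> form_domain J \<Longrightarrow> dirichlet_form J u v + \<gamma> * l2_inner u v = l2_inner \<phi> v"
  shows "(LINT x|lborel. (\<phi> x - \<gamma> * u x)\<^sup>2 * weight x)
         \<le> 2 * M * \<delta>\<^sup>2 * (LINT x|lborel. weight (x::'a))"
proof -
  define w where "w x = \<phi> x - \<gamma> * u x" for x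
  define v where "v x = w x * weight x" for x
  have uL: "u \<in> L2" and \<phi>L: "\<phi> \<in> L2"
    using u \<phi> by (auto simp: form_domain_def intro: C1_in_L2)
  have "(\<lambda>x. 1 * \<phi> x + (- \<gamma>) * u x) \<in> L2"
    by (intro L2_lincomb \<phi>L uL)
  then have wL: "w \<in> L2"
    by (simp add: w_def[abs_def])
  have vF: "v \<in> form_domain J"
    unfolding v_def[abs_def] w_def by (rule weighted_combination_in_form_domain[OF u \<phi>])
  then have vL: "v \<in> L2"
    by (simp add: form_domain_def)
  have [measurable]: "u \<in> borel_measurable borel" "\<phi> \<in> borel_measurable borel"
      "w \<in> borel_measurable borel" "v \<in> borel_measurable borel"
    using uL \<phi>L wL vL by (auto simp: L2_def)
  let ?W = "LINT x|lborel. (w x)\<^sup>2 * weight x" and ?I = "LINT x|lborel. weight (x::'a)"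
  have int_w: "integrable lborel (\<lambda>x. (w x)\<^sup>2 * weight x)"
    using integrable_mult_L2[OF wL vL] by (simp add: v_def power2_eq_square mult.assoc)
  have "dirichlet_form J u v = l2_inner \<phi> v - \<gamma> * l2_inner u v"
    using eq[OF vF] by simp
  also have "\<dots> = (LINT x|lborel. \<phi> x * v x - \<gamma> * (u x * v x))"
    unfolding l2_inner_def using integrable_mult_L2[OF \<phi>L vL] integrable_mult_L2[OF uL vL] by simp
  also have "(\<lambda>x. \<phi> x * v x - \<gamma> * (u x * v x)) = (\<lambda>x. (w x)\<^sup>2 * weight x)"
    by (auto simp: v_def w_def power2_eq_square algebra_simps)
  finally have D: "dirichlet_form J u v = ?W" .
  define g where "g x = \<delta>\<^sup>2 * weight x + 4 * ((w x)\<^sup>2 * weight x)" for x :: 'a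
  have g_nonneg: "0 \<le> g x" for x
    using weight_pos[of x] by (auto simp: g_def less_imp_le)
  have [measurable]: "g \<in> borel_measurable borel"
    unfolding g_def by measurable
  let ?G = "\<lambda>(x, y). (norm (x - y))\<^sup>2 * J x y * (g x + g y)"
  have le: "\<gamma> * ((u y - u x) * (v y - v x) * J x y) \<le> ?G (x, y)" for x y
  proof (cases "norm (x - y) \<le> 1")
    case True
    define a c A W b r m where "a = w y - w x" and "c = \<phi> y - \<phi> x"
      and "A = (weight x + weight y) / 2" and "W = (w x + w y) / 2"
      and "b = weight y - weight x" and "r = norm (x - y)" and "m = min (weight x) (weight y)"
    note defs = this
    \<comment> \<open>This is $\gamma u = \phi - w$ together with the symmetric product rule for $w\eta$.\<close>
    have "\<gamma> * ((u y - u x) * (v y - v x)) = (c - a) * (a * A + W * b)"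
      unfolding defs v_def w_def by (simp add: field_simps)
    also have "\<dots> \<le> 2 * c\<^sup>2 * A + 8 * W\<^sup>2 * r\<^sup>2 * m"
    proof (rule weighted_energy_pointwise)
      show "0 < A" "0 \<le> m" "m \<le> A"
        using weight_pos[of x] weight_pos[of y] by (auto simp: defs min_def)
      show "\<bar>b\<bar> \<le> 2 * r * m"
        using weight_diff_le[OF True] weight_diff_le[of y x] True
        by (auto simp: defs min_def norm_minus_commute abs_minus_commute)
    qed
    also have "\<dots> \<le> r\<^sup>2 * (g x + g y)"
    proof -
      have "\<bar>c\<bar> \<le> \<delta> * r"
        using lip[of y x] by (simp add: defs norm_minus_commute)
      from power_mono[OF this abs_ge_zero, of 2] have "c\<^sup>2 \<le> \<delta>\<^sup>2 * r\<^sup>2"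
        by (simp only: power2_abs power_mult_distrib)
      then have 1: "2 * c\<^sup>2 * A \<le> 2 * (\<delta>\<^sup>2 * r\<^sup>2) * A"
        using weight_pos[of x] weight_pos[of y] by (intro mult_right_mono mult_left_mono) (auto simp: defs)
      have "2 * (w x * w y) \<le> (w x)\<^sup>2 + (w y)\<^sup>2"
        using sum_squares_bound[of "w x" "w y"] by simp
      then have "2 * W\<^sup>2 \<le> (w x)\<^sup>2 + (w y)\<^sup>2"
        by (simp add: defs power2_eq_square field_simps)
      then have "2 * W\<^sup>2 * m \<le> ((w x)\<^sup>2 + (w y)\<^sup>2) * m"
        using weight_pos[of x] weight_pos[of y] by (intro mult_right_mono) (auto simp: defs)
      also have "\<dots> = (w x)\<^sup>2 * m + (w y)\<^sup>2 * m"
        by (rule distrib_right)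
      also have "\<dots> \<le> (w x)\<^sup>2 * weight x + (w y)\<^sup>2 * weight y"
        by (intro add_mono mult_left_mono) (auto simp: defs)
      finally have 2: "4 * r\<^sup>2 * (2 * W\<^sup>2 * m) \<le> 4 * r\<^sup>2 * ((w x)\<^sup>2 * weight x + (w y)\<^sup>2 * weight y)"
        by (intro mult_left_mono) auto
      have "2 * c\<^sup>2 * A + 8 * W\<^sup>2 * r\<^sup>2 * m = 2 * c\<^sup>2 * A + 4 * r\<^sup>2 * (2 * W\<^sup>2 * m)"
        by simp
      also have "\<dots> \<le> 2 * (\<delta>\<^sup>2 * r\<^sup>2) * A + 4 * r\<^sup>2 * ((w x)\<^sup>2 * weight x + (w y)\<^sup>2 * weight y)"
        by (rule add_mono[OF 1 2])
      also have "\<dots> = r\<^sup>2 * (g x + g y)"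
        by (simp add: g_def A_def algebra_simps)
      finally show ?thesis .
    qed
    finally have "\<gamma> * ((u y - u x) * (v y - v x)) * J x y \<le> r\<^sup>2 * (g x + g y) * J x y"
      by (rule mult_right_mono) (rule J_nonneg)
    then show ?thesis
      by (simp add: r_def mult_ac)
  next
    case False
    then show ?thesis using J_range[of x y] by simp
  qed
  have int_g: "integrable lborel g"
    unfolding g_def using int_w integrable_weight by auto
  have ig: "(LINT x|lborel. g x) = \<delta>\<^sup>2 * ?I + 4 * ?W"
    unfolding g_def using int_w integrable_weight
    by (subst Bochner_Integration.integral_add) auto
  have "(\<integral>\<^sup>+z. ennreal (?G z) \<partial>(lborel \<Otimes>\<^sub>M lborel)) \<le> ennreal (2 * M) * (\<integral>\<^sup>+x. ennreal (g x) \<partial>lborel)"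
  proof -
    have "g \<in> borel_measurable borel"
      by measurable
    moreover have "ennreal (?G z) = (case z of (x, y) \<Rightarrow> ennreal ((norm (x - y))\<^sup>2 * J x y * (g x + g y)))" for z
      by (cases z) simp
    ultimately show ?thesis
      by (simp only: nn_integral_moment_times_le g_nonneg)
  qed
  also have "(\<integral>\<^sup>+x. ennreal (g x) \<partial>lborel) = ennreal (LINT x|lborel. g x)"
    using int_g g_nonneg by (intro nn_integral_eq_integral) auto
  also have "ennreal (2 * M) * \<dots> = ennreal (2 * M * (LINT x|lborel. g x))"
    using M_nonneg by (intro ennreal_mult'[symmetric]) simp
  finally have G_le: "(\<integral>\<^sup>+z. ennreal (?G z) \<partial>(lborel \<Otimes>\<^sub>M lborel)) \<le> ennreal (2 * M * (LINT x|lborel. g x))" .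
  have G_nonneg: "0 \<le> ?G z" for z
    using g_nonneg J_nonneg by (cases z) (simp add: add_nonneg_nonneg)
  have G_meas: "?G \<in> borel_measurable (lborel \<Otimes>\<^sub>M lborel)"
    by measurable
  have int_G: "integrable (lborel \<Otimes>\<^sub>M lborel) ?G"
    using G_le by (intro integrableI_nonneg G_meas AE_I2 G_nonneg) (rule le_less_trans, auto)
  have "\<gamma> * ?W = (LINT z|(lborel \<Otimes>\<^sub>M lborel). \<gamma> * (case z of (x, y) \<Rightarrow> (u y - u x) * (v y - v x) * J x y))"
    unfolding D[symmetric] dirichlet_form_def by (rule integral_mult_right_zero[symmetric])
  also have "\<dots> \<le> (LINT z|(lborel \<Otimes>\<^sub>M lborel). ?G z)"
    using le by (intro integral_mono'[OF int_G] G_nonneg) auto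
  also have "\<dots> \<le> 2 * M * (LINT x|lborel. g x)"
    using G_le nn_integral_eq_integral[OF int_G AE_I2[OF G_nonneg]] M_nonneg
    by (simp add: integral_nonneg g_nonneg)
  finally have "\<gamma> * ?W \<le> 2 * M * \<delta>\<^sup>2 * ?I + 8 * M * ?W"
    unfolding ig by (simp add: algebra_simps)
  then show ?thesis
    unfolding \<gamma> w_def by (simp add: algebra_simps)
qed

end

section \<open>No mass is lost by the semigroup\<close>

lemma nn_integral_exp_Ici:
  assumes "0 < \<gamma>"
  shows "(\<integral>\<^sup>+t. ennreal (exp (- \<gamma> * t)) * indicator {a..} t \<partial>lborel) = ennreal (exp (- \<gamma> * a) / \<gamma>)"
proof -
  have "(\<integral>\<^sup>+t. ennreal (exp (- \<gamma> * t)) * indicator {a..} t \<partial>lborel) = ennreal (0 - (- exp (- \<gamma> * a) / \<gamma>))"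
  proof (rule nn_integral_FTC_atLeast)
    show "((\<lambda>t. - exp (- \<gamma> * t) / \<gamma>) has_real_derivative exp (- \<gamma> * t)) (at t)" for t
      using assms by (auto intro!: derivative_eq_intros)
    show "((\<lambda>t. - exp (- \<gamma> * t) / \<gamma>) \<longlongrightarrow> 0) at_top"
      using assms by real_asymp
  qed auto
  then show ?thesis by simp
qed

lemma has_bochner_integral_exp_Ici:
  fixes \<gamma> a :: real
  assumes "0 < \<gamma>"
  shows "has_bochner_integral lborel (\<lambda>t. indicator {a..} t * exp (- \<gamma> * t)) (exp (- \<gamma> * a) / \<gamma>)"
proof (rule has_bochner_integral_nn_integral)
  have "(\<integral>\<^sup>+t. ennreal (indicator {a..} t * exp (- \<gamma> * t)) \<partial>lborel)
      = (\<integral>\<^sup>+t. ennreal (exp (- \<gamma> * t)) * indicator {a..} t \<partial>lborel)"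
    by (intro nn_integral_cong) (auto split: split_indicator)
  then show "(\<integral>\<^sup>+t. ennreal (indicator {a..} t * exp (- \<gamma> * t)) \<partial>lborel) = ennreal (exp (- \<gamma> * a) / \<gamma>)"
    by (simp only: nn_integral_exp_Ici[OF assms])
qed (use assms in auto)

text \<open>A deficit \<open>I - H\<close> from time \<open>t\<^sub>0\<close> on lowers the Laplace transform by its discounted value. If
  the integral on the left does not exist, its value is $0$ by convention, and the right side is
  nonnegative.\<close>
lemma laplace_transform_le:
  fixes q :: "real \<Rightarrow> real"
  assumes \<gamma>: "0 < \<gamma>" and t0: "0 \<le> t\<^sub>0" and H: "0 \<le> H" "H \<le> I"
    and le: "\<And>t. 0 \<le> t \<Longrightarrow> q t \<le> I" "\<And>t. t\<^sub>0 \<le> t \<Longrightarrow> q t \<le> H"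
  shows "\<gamma> * (LINT t:{0..}|lborel. exp (- \<gamma> * t) * q t) \<le> I - (I - H) * exp (- \<gamma> * t\<^sub>0)"
proof -
  let ?B = "\<lambda>t. I * (indicator {0..} t * exp (- \<gamma> * t)) - (I - H) * (indicator {t\<^sub>0..} t * exp (- \<gamma> * t))"
  have B: "has_bochner_integral lborel ?B (I * (exp (- \<gamma> * 0) / \<gamma>) - (I - H) * (exp (- \<gamma> * t\<^sub>0) / \<gamma>))"
    by (intro has_bochner_integral_diff has_bochner_integral_mult_right has_bochner_integral_exp_Ici \<gamma>)
  have "(LINT t:{0..}|lborel. exp (- \<gamma> * t) * q t) \<le> (LINT t|lborel. ?B t)"
    unfolding set_lebesgue_integral_def
  proof (rule integral_mono')
    show "integrable lborel ?B"
      using B unfolding has_bochner_integral_iff by (rule conjunct1)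
    fix t
    have 1: "exp (- \<gamma> * t) * q t \<le> exp (- \<gamma> * t) * I" if "0 \<le> t"
      using le(1)[OF that] by (intro mult_left_mono) auto
    have 2: "exp (- \<gamma> * t) * q t \<le> exp (- \<gamma> * t) * H" if "t\<^sub>0 \<le> t"
      using le(2)[OF that] by (intro mult_left_mono) auto
    show "indicator {0..} t *\<^sub>R (exp (- \<gamma> * t) * q t) \<le> ?B t"
      using 1 2 t0 by (auto simp: algebra_simps split: split_indicator)
    show "0 \<le> ?B t"
      using H t0 by (auto simp: algebra_simps split: split_indicator)
  qed
  also have "(LINT t|lborel. ?B t) = I * (exp (- \<gamma> * 0) / \<gamma>) - (I - H) * (exp (- \<gamma> * t\<^sub>0) / \<gamma>)"
    using B by (rule has_bochner_integral_integral_eq)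
  also have "\<dots> = (I - (I - H) * exp (- \<gamma> * t\<^sub>0)) / \<gamma>"
    by (simp add: diff_divide_distrib)
  finally show ?thesis
    using \<gamma> by (simp add: pos_le_divide_eq mult.commute)
qed

context jump_kernel_second_moment
begin

text \<open>The $L^2$ smallness of $w$ gives smallness of $\int w\eta$ by
  $w \le 2/R + (R/8) w^2$, where the two summands contribute equally in order to the bound $O(1/R)$.\<close>
lemma resolvent_of_cutoff_le:
  assumes \<gamma>: "\<gamma> = 8 * M + 1" and R: "0 < R"
    and u: "u \<in> form_domain J"
    and eq: "\<And>v. v \<in> form_domain J \<Longrightarrow> dirichlet_form J u v + \<gamma> * l2_inner u v = l2_inner (cutoff R) v"
  shows "l2_inner (cutoff R) (weight :: 'a \<Rightarrow> real)
    \<le> \<gamma> * l2_inner u weight + (2 + 4 * M) / R * (LINT x|lborel. weight (x::'a))"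
proof -
  define w where "w x = cutoff R x - \<gamma> * u x" for x
  let ?W = "LINT x|lborel. (w x)\<^sup>2 * weight x" and ?I = "LINT x|lborel. weight (x::'a)"
  have uL: "u \<in> L2" and cL: "(cutoff R :: 'a \<Rightarrow> real) \<in> L2"
    using u R by (auto simp: form_domain_def intro: C1_in_L2 cutoff_C1)
  have "(\<lambda>x. 1 * cutoff R x + (- \<gamma>) * u x) \<in> L2"
    by (intro L2_lincomb cL uL)
  then have wL: "w \<in> L2"
    by (simp add: w_def[abs_def])
  then have w2L: "(\<lambda>x. w x * weight x) \<in> L2"
    using weight_pos[where 'a='a] weight_le_1[where 'a='a]
    by (intro L2_mult_bounded) (auto simp: less_imp_le)
  have int_w2: "integrable lborel (\<lambda>x. (w x)\<^sup>2 * weight x)"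
    using integrable_mult_L2[OF wL w2L] by (simp add: power2_eq_square mult.assoc)
  have int_w: "integrable lborel (\<lambda>x. w x * weight x)"
    by (rule integrable_mult_L2[OF wL weight_in_L2])
  have W: "?W \<le> 2 * M * (4 / R)\<^sup>2 * ?I"
    unfolding w_def
    by (rule weighted_resolvent_estimate[OF \<gamma> u cutoff_C1[OF R] cutoff_lipschitz[OF R] eq])
  have "l2_inner (cutoff R) (weight :: 'a \<Rightarrow> real) - \<gamma> * l2_inner u weight
      = (LINT x|lborel. cutoff R x * weight x - \<gamma> * (u x * weight x))"
    unfolding l2_inner_def
    using integrable_mult_L2[OF cL weight_in_L2] integrable_mult_L2[OF uL weight_in_L2] by simp
  also have "\<dots> = (LINT x|lborel. w x * weight x)"
    by (simp add: w_def algebra_simps)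
  also have "\<dots> \<le> (LINT x|lborel. (2 / R) * weight x + (R / 8) * ((w x)\<^sup>2 * weight x))"
  proof (intro integral_mono int_w Bochner_Integration.integrable_add integrable_mult_right integrable_weight int_w2)
    fix x
    have "0 \<le> (4 / R - w x)\<^sup>2" by simp
    then have "w x * (8 / R) \<le> 16 / R\<^sup>2 + (w x)\<^sup>2"
      by (simp add: power2_diff power_divide mult.commute)
    then have "(R / 8) * (w x * (8 / R)) \<le> (R / 8) * (16 / R\<^sup>2 + (w x)\<^sup>2)"
      using R by (intro mult_left_mono) auto
    then have "w x \<le> 2 / R + (R / 8) * (w x)\<^sup>2"
      using R by (simp add: distrib_left power2_eq_square)
    then have "w x * weight x \<le> (2 / R + (R / 8) * (w x)\<^sup>2) * weight x"
      using weight_pos[of x] by (intro mult_right_mono) auto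
    then show "w x * weight x \<le> (2 / R) * weight x + (R / 8) * ((w x)\<^sup>2 * weight x)"
      by (simp add: algebra_simps)
  qed
  also have "\<dots> = (2 / R) * ?I + (R / 8) * ?W"
    using int_w2 integrable_weight
    by (subst Bochner_Integration.integral_add) auto
  also have "\<dots> \<le> (2 / R) * ?I + (R / 8) * (2 * M * (4 / R)\<^sup>2 * ?I)"
    using R W by (intro add_left_mono mult_left_mono) auto
  also have "(R / 8) * (2 * M * (4 / R)\<^sup>2 * ?I) = 4 * M / R * ?I"
    using R by (simp add: power2_eq_square)
  finally show ?thesis
    by (simp add: add_divide_distrib distrib_right)
qed

text \<open>Letting $R \to \infty$ in the resolvent estimate gives
  $\int\eta \le \int\eta - e^{-\gamma t}\int(1 - h_t)\eta$, so that $h_t = 1$ almost everywhere, as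
  the weight is strictly positive. In the application, $h_t(x)$ is the probability of being alive at
  time $t$.\<close>
lemma semigroup_conservative:
  assumes T: "form_semigroup J T"
    and h_meas: "\<And>t. h t \<in> borel_measurable borel"
    and h: "\<And>t x. 0 \<le> h t x" "\<And>t x. h t x \<le> 1"
    and antimono: "\<And>s t x. 0 < s \<Longrightarrow> s \<le> t \<Longrightarrow> h t x \<le> h s x"
    and dominates: "\<And>t R. 0 < t \<Longrightarrow> 0 < R \<Longrightarrow> AE x in lborel. T t (cutoff R) x \<le> h t (x::'a)"
    and t: "0 < t"
  shows "AE x in lborel. h t x = 1"
proof -
  interpret l2_contraction_semigroup T
    using T by (simp add: form_semigroup_def)
  define \<gamma> where "\<gamma> = 8 * M + 1"
  have \<gamma>: "0 < \<gamma>"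
    using M_nonneg by (simp add: \<gamma>_def)
  let ?I = "LINT x|lborel. weight (x::'a)" and ?H = "\<lambda>s. LINT x|lborel. h s x * weight x"
  have int_h: "integrable lborel (\<lambda>x. h s x * weight x)" for s
    by (intro integrable_mult_weight h_meas h)
  have H_nonneg: "0 \<le> ?H s" for s
    using h weight_pos[where 'a='a] by (intro Bochner_Integration.integral_nonneg) (simp add: less_imp_le)
  have H_le: "?H s \<le> ?I" for s
    using h weight_pos[where 'a='a]
    by (intro integral_mono int_h integrable_weight) (simp add: less_imp_le mult_left_le_one_le)
  have H_antimono: "?H s \<le> ?H t" if "t \<le> s" for s
    using antimono[OF t that] weight_pos[where 'a='a]
    by (intro integral_mono int_h mult_right_mono) (auto simp: less_imp_le)
  have cL: "(cutoff R :: 'a \<Rightarrow> real) \<in> L2" if "0 < R" for R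
    using that by (intro C1_in_L2 cutoff_C1)
  have int_T: "integrable lborel (\<lambda>x. T s (cutoff R) x * weight x)" if "0 \<le> s" "0 < R" for s R
    by (intro integrable_mult_L2 in_L2 weight_in_L2 cL that)
  have T_le_H: "l2_inner (T s (cutoff R)) weight \<le> ?H s" if "0 < s" "0 < R" for s R
    unfolding l2_inner_def
  proof (rule integral_mono_AE[OF int_T int_h])
    show "AE x in lborel. T s (cutoff R) x * weight x \<le> h s x * weight x"
      using dominates[OF that] by eventually_elim (simp add: mult_right_mono less_imp_le[OF weight_pos])
  qed (use that in auto)
  have T_le_I: "l2_inner (T s (cutoff R)) weight \<le> ?I" if "0 \<le> s" "0 < R" for s R
  \<comment> \<open>The hypothesis on \<open>h\<close> starts at positive times; at time 0 the semigroup is the identity.\<close>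
  proof (cases "s = 0")
    case True
    show ?thesis
      unfolding l2_inner_def
    proof (rule integral_mono_AE[OF int_T integrable_weight])
      show "AE x in lborel. T s (cutoff R) x * weight x \<le> weight x"
        using zero[OF cL[OF that(2)]] unfolding True
        by eventually_elim (simp add: mult_left_le_one_le cutoff_bounds less_imp_le[OF weight_pos])
    qed (use that in auto)
  next
    case False
    with T_le_H[of s R] H_le[of s] that show ?thesis by simp
  qed
  have main: "l2_inner (cutoff R) (weight :: 'a \<Rightarrow> real) \<le> ?I - (?I - ?H t) * exp (- \<gamma> * t) + (2 + 4 * M) / R * ?I"
    if R: "0 < R" for R
  proof -
    obtain u where u: "u \<in> form_domain J"
      and lap: "\<And>v. v \<in> L2 \<Longrightarrow> l2_inner u v = (LINT t:{0..}|lborel. exp (- \<gamma> * t) * l2_inner (T t (cutoff R)) v)"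
      and eq: "\<And>v. v \<in> form_domain J \<Longrightarrow> dirichlet_form J u v + \<gamma> * l2_inner u v = l2_inner (cutoff R) v"
      using T \<gamma> cL[OF R] unfolding form_semigroup_def by blast
    have "\<gamma> * l2_inner u weight \<le> ?I - (?I - ?H t) * exp (- \<gamma> * t)"
      unfolding lap[OF weight_in_L2]
    proof (rule laplace_transform_le[OF \<gamma> _ H_nonneg H_le])
      show "l2_inner (T s (cutoff R)) weight \<le> ?H t" if "t \<le> s" for s
        using T_le_H[of s R] H_antimono[OF that] t that R by linarith
    qed (use t R T_le_I in auto)
    with resolvent_of_cutoff_le[OF \<gamma>_def R u eq] show ?thesis
      by linarith
  qed
  have lim1: "(\<lambda>n. l2_inner (cutoff (real (Suc n))) (weight :: 'a \<Rightarrow> real)) \<longlonglongrightarrow> ?I"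
    unfolding l2_inner_def
  proof (rule integral_dominated_convergence[where w=weight])
    show "AE x in lborel. (\<lambda>n. cutoff (real (Suc n)) x * weight x) \<longlonglongrightarrow> weight (x::'a)"
    proof (intro AE_I2)
      fix x :: 'a
      have "(\<lambda>n. cutoff (real (Suc n)) x * weight x) \<longlonglongrightarrow> 1 * weight x"
        by (intro tendsto_mult cutoff_tendsto_1 tendsto_const)
      then show "(\<lambda>n. cutoff (real (Suc n)) x * weight x) \<longlonglongrightarrow> weight x"
        by simp
    qed
    show "AE x in lborel. norm (cutoff (real (Suc n)) x * weight x) \<le> weight (x::'a)" for n
      using cutoff_bounds[where 'a='a] weight_pos[where 'a='a]
      by (intro AE_I2) (simp add: abs_mult abs_of_nonneg less_imp_le)
  qed (use integrable_weight in auto)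
  have lim2: "(\<lambda>n. ?I - (?I - ?H t) * exp (- \<gamma> * t) + (2 + 4 * M) / real (Suc n) * ?I)
      \<longlonglongrightarrow> ?I - (?I - ?H t) * exp (- \<gamma> * t) + 0 * ?I"
    by (intro tendsto_intros LIMSEQ_Suc[OF lim_const_over_n])
  have "?I \<le> ?I - (?I - ?H t) * exp (- \<gamma> * t) + 0 * ?I"
    by (rule LIMSEQ_le[OF lim1 lim2]) (use main in auto)
  then have "(?I - ?H t) * exp (- \<gamma> * t) \<le> 0"
    by simp
  then have "?I \<le> ?H t"
    by (simp add: mult_le_0_iff)
  moreover have "(LINT x|lborel. (1 - h t x) * weight x) = ?I - ?H t"
    unfolding left_diff_distrib mult_1 by (rule Bochner_Integration.integral_diff[OF integrable_weight int_h])
  moreover have nn: "0 \<le> (1 - h t x) * weight x" for x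
    using h[of t x] weight_pos[of x] by simp
  then have "0 \<le> (LINT x|lborel. (1 - h t x) * weight x)"
    by (intro Bochner_Integration.integral_nonneg)
  ultimately have "(LINT x|lborel. (1 - h t x) * weight x) = 0"
    by linarith
  moreover have "integrable lborel (\<lambda>x. (1 - h t x) * weight x)"
    unfolding left_diff_distrib mult_1 by (rule Bochner_Integration.integrable_diff[OF integrable_weight int_h])
  ultimately have "AE x in lborel. (1 - h t x) * weight x = 0"
    using integral_nonneg_eq_0_iff_AE nn by blast
  then show ?thesis
  proof eventually_elim
    case (elim x)
    with weight_pos[of x] show ?case by simp
  qed
qed

end

section \<open>Sets of capacity zero\<close>

text \<open>A function of small energy that is at least $1$ on a neighbourhood of $N$ bounds the volume of that
  neighbourhood by its squared $L^2$ norm.\<close>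
lemma capacity_zero_imp_null:
  assumes "capacity J N = 0"
  shows "AE x in lborel. x \<notin> N"
proof -
  have "\<exists>U. open U \<and> N \<subseteq> U \<and> emeasure lborel U \<le> ennreal (1 / real (Suc n))" for n
  proof -
    have "capacity J N < ennreal (1 / real (Suc n))"
      using assms by simp
    then obtain f U where U: "open U" "N \<subseteq> U" and f: "f \<in> form_domain J"
      and ge: "AE x in lborel. x \<in> U \<longrightarrow> 1 \<le> f x" and lt: "energy1 J f < ennreal (1 / real (Suc n))"
      unfolding capacity_def Inf_less_iff by blast
    have "emeasure lborel U = (\<integral>\<^sup>+x. indicator U x \<partial>lborel)"
      using U by simp
    also have "\<dots> \<le> (\<integral>\<^sup>+x. ennreal ((f x)\<^sup>2) \<partial>lborel)"
    proof (intro nn_integral_mono_AE, use ge in eventually_elim)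
      fix x assume "x \<in> U \<longrightarrow> 1 \<le> f x"
      then show "indicator U x \<le> ennreal ((f x)\<^sup>2)"
        by (auto split: split_indicator simp: one_le_power simp flip: ennreal_1 intro!: ennreal_leI)
    qed
    also have "\<dots> \<le> energy1 J f"
      unfolding energy1_def by (rule add_increasing) auto
    finally show ?thesis
      using U lt by (meson less_imp_le order_trans)
  qed
  then have "\<forall>n. \<exists>U. open U \<and> N \<subseteq> U \<and> emeasure lborel U \<le> ennreal (1 / real (Suc n))"
    by (rule allI)
  from choice[OF this] obtain U where *: "\<forall>n. open (U n) \<and> N \<subseteq> U n \<and> emeasure lborel (U n) \<le> ennreal (1 / real (Suc n))"
    by (rule exE)
  have U: "open (U n)" "N \<subseteq> U n" for n
    using spec[OF *, of n] by blast+
  have le: "emeasure lborel (U n) \<le> ennreal (1 / real (Suc n))" for n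
    using spec[OF *, of n] by blast
  have "emeasure lborel (\<Inter>n. U n) \<le> 0"
  proof (rule LIMSEQ_le_const)
    show "(\<lambda>n. ennreal (1 / real (Suc n))) \<longlonglongrightarrow> 0"
      using tendsto_ennrealI[OF LIMSEQ_Suc[OF lim_const_over_n[of 1]]] unfolding ennreal_0 of_nat_1 .
    have "emeasure lborel (\<Inter>n. U n) \<le> ennreal (1 / real (Suc n))" for n
    proof -
      have "emeasure lborel (\<Inter>n. U n) \<le> emeasure lborel (U n)"
        using U(1)[of n] by (intro emeasure_mono) auto
      also note le
      finally show ?thesis .
    qed
    then show "\<exists>k. \<forall>n\<ge>k. emeasure lborel (\<Inter>n. U n) \<le> ennreal (1 / real (Suc n))"
      by blast
  qed
  moreover have "(\<Inter>n. U n) \<in> sets lborel"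
    using U(1) by auto
  ultimately have "(\<Inter>n. U n) \<in> null_sets lborel"
    by (intro null_setsI) auto
  from AE_not_in[OF this] show ?thesis
    by eventually_elim (use U(2) in blast)
qed

section \<open>Survival of a Hunt process\<close>

lemma Some_measurable: "Some \<in> borel \<rightarrow>\<^sub>M (cemetery_borel :: 'a::euclidean_space option measure)"
  unfolding cemetery_borel_def
proof (rule measurable_measure_of)
  fix V assume "V \<in> {V::'a option set. openin cemetery_top V}"
  then consider U where "open U" "V = Some ` U" | C where "closed C" "V = insert None (Some ` (- C))"
    by (auto simp: openin_Alexandroff_compactification Compl_eq_Diff_UNIV)
  then have "open (Some -` V)"
  proof cases
    case 1
    then show ?thesis by (simp add: inj_vimage_image_eq)
  next
    case 2
    moreover have "Some -` insert None (Some ` (- C)) = - C"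
      by auto
    ultimately show ?thesis by (simp add: open_Compl)
  qed
  then show "Some -` V \<inter> space borel \<in> sets borel"
    by simp
qed auto

lemma image_Some_in_cemetery_borel:
  assumes "A \<in> sets (borel :: 'a::euclidean_space measure)"
  shows "Some ` A \<in> sets cemetery_borel"
proof -
  have open_case: "Some ` U \<in> sets (cemetery_borel :: 'a option measure)" if "open U" for U
    unfolding cemetery_borel_def using that by (auto intro!: sigma_sets.Basic)
  have "A \<in> sigma_sets UNIV {U. open U}"
    using assms by (simp add: borel_def)
  then show ?thesis
  proof induction
    case (Basic U)
    then show ?case by (simp add: open_case)
  next
    case Empty
    show ?case by simp
  next
    case (Compl A)
    have "range Some - Some ` A \<in> sets (cemetery_borel :: 'a option measure)"
      by (intro sets.Diff Compl.IH open_case open_UNIV)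
    also have "range Some - Some ` A = Some ` (UNIV - A)"
      by auto
    finally show ?case .
  next
    case (Union A)
    then have "(\<Union>i. Some ` A i) \<in> sets (cemetery_borel :: 'a option measure)"
      by auto
    then show ?case
      by (simp add: image_UN)
  qed
qed

lemma range_Some_in_cemetery_borel: "range Some \<in> sets (cemetery_borel :: 'a::euclidean_space option measure)"
  by (rule image_Some_in_cemetery_borel) simp

context hunt_process
begin

lemma space_P: "z \<in> with_cemetery S \<Longrightarrow> space (P z) = space \<Omega>"
  by (rule sets_eq_imp_space_eq) (rule sets_P)

definition alive :: "ennreal \<Rightarrow> 'w set" where
  "alive t = {\<omega> \<in> space \<Omega>. X t \<omega> \<in> range Some}"

lemma alive_in_F: "alive t \<in> sets (F t)"
proof -
  have "X t -` range Some \<inter> space (F t) \<in> sets (F t)"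
    by (rule measurable_sets[OF adapted range_Some_in_cemetery_borel])
  also have "X t -` range Some \<inter> space (F t) = alive t"
    by (auto simp: alive_def space_F)
  finally show ?thesis .
qed

lemma alive_in_sets: "alive t \<in> sets \<Omega>"
  using alive_in_F sets_F by blast

text \<open>The cemetery is absorbing.\<close>
lemma alive_antimono:
  assumes "s \<le> t"
  shows "alive t \<subseteq> alive s"
proof
  fix \<omega> assume \<omega>: "\<omega> \<in> alive t"
  have "X s \<omega> \<noteq> None"
  proof
    assume "X s \<omega> = None"
    then have "lifetime X \<omega> \<le> s"
      unfolding lifetime_def by (intro Inf_lower) simp
    with assms have "lifetime X \<omega> \<le> t"
      by (rule order_trans[rotated])
    with \<omega> absorbed[of \<omega> t] show False
      by (auto simp: alive_def)
  qed
  then show "\<omega> \<in> alive s"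
    using \<omega> by (auto simp: alive_def)
qed

definition survival :: "ennreal \<Rightarrow> 'a \<Rightarrow> real" where
  "survival t x = measure (P (Some x)) (alive t)"

lemma survival_measurable: "survival t \<in> borel_measurable (restrict_space borel S)"
proof -
  have "Some \<in> restrict_space borel S \<rightarrow>\<^sub>M restrict_space cemetery_borel (with_cemetery S)"
    by (rule measurable_restrict_space3[OF Some_measurable]) auto
  from measurable_compose[OF this kernel_measurable[OF range_Some_in_cemetery_borel, of t]]
  show ?thesis
    by (simp add: survival_def[abs_def] alive_def)
qed

lemma survival_antimono:
  assumes "s \<le> t" "x \<in> S"
  shows "survival t x \<le> survival s x"
proof -
  interpret prob_space "P (Some x)"
    using assms by (intro prob_space_P) auto
  show ?thesis
    unfolding survival_def using assms
    by (intro finite_measure_mono alive_antimono) (auto simp: sets_P alive_in_sets)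
qed

lemma survival_le_1: "x \<in> S \<Longrightarrow> survival t x \<le> 1"
  unfolding survival_def by (intro prob_space.prob_le_1 prob_space_P) auto

text \<open>Points of the state space form an open set in the compactification, so a right-continuous path
  that starts in one is alive for a short time.\<close>
lemma survival_small_times:
  assumes x: "x \<in> S"
  shows "(\<lambda>n. survival (ennreal (1 / real (Suc n))) x) \<longlonglongrightarrow> 1"
proof -
  have x': "Some x \<in> with_cemetery S"
    using x by simp
  interpret prob_space "P (Some x)"
    using x' by (rule prob_space_P)
  let ?A = "\<lambda>n. alive (ennreal (1 / real (Suc n)))"
  have sets: "range ?A \<subseteq> events"
    using alive_in_sets by (auto simp: sets_P[OF x'])
  have "incseq ?A"
    by (intro incseq_SucI alive_antimono ennreal_leI) (simp add: field_simps)
  then have "(\<lambda>n. prob (?A n)) \<longlonglongrightarrow> prob (\<Union>n. ?A n)"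
    by (rule finite_Lim_measure_incseq[OF sets])
  moreover have "prob (\<Union>n. ?A n) = 1"
  proof -
    have "AE \<omega> in P (Some x). \<omega> \<in> (\<Union>n. ?A n)"
      using normal[OF x'] AE_space
    proof eventually_elim
      case (elim \<omega>)
      then have \<omega>: "\<omega> \<in> space \<Omega>"
        by (simp add: space_P[OF x'])
      have "eventually (\<lambda>s. X s \<omega> \<in> range Some) (at_right 0)"
        using limitinD[OF right_continuous[OF \<omega>, of 0], of "range Some"] elim(1) by simp
      moreover have "filterlim (\<lambda>n. ennreal (1 / real (Suc n))) (at_right 0) sequentially"
      proof (rule tendsto_imp_filterlim_at_right)
        show "(\<lambda>n. ennreal (1 / real (Suc n))) \<longlonglongrightarrow> 0"
          using tendsto_ennrealI[OF LIMSEQ_Suc[OF lim_const_over_n[of 1]]] by simp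
      qed simp
      ultimately have "eventually (\<lambda>n. X (ennreal (1 / real (Suc n))) \<omega> \<in> range Some) sequentially"
        by (rule eventually_compose_filterlim)
      then obtain n where "X (ennreal (1 / real (Suc n))) \<omega> \<in> range Some"
        unfolding eventually_sequentially by blast
      with \<omega> show ?case
        by (auto simp: alive_def)
    qed
    moreover have "(\<Union>n. ?A n) \<in> events"
      using sets by auto
    ultimately show ?thesis
      by (rule AE_in_set_eq_1[THEN iffD1, rotated])
  qed
  ultimately show ?thesis
    by (simp add: survival_def)
qed

text \<open>The Markov property at the deterministic time \<open>s\<close>: if the process is at time \<open>s\<close> either dead or at a
  point from which it survives the next \<open>t\<close> units of time, then almost surely it does not die between \<open>s\<close> and \<open>s + t\<close>.\<close>
lemma survival_markov:
  assumes x: "x \<in> S"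
    and conservative: "AE \<omega> in P (Some x). X s \<omega> = None \<or> (\<exists>y. X s \<omega> = Some y \<and> survival t y = 1)"
  shows "survival s x \<le> survival (s + t) x"
proof -
  have x': "Some x \<in> with_cemetery S"
    using x by simp
  interpret prob_space "P (Some x)"
    using x' by (rule prob_space_P)
  let ?G = "pre_sigma (\<lambda>_. s)"
  have st: "stopping_time F (\<lambda>_. s)"
    by (rule stopping_time_const)
  have sub: "subalgebra (P (Some x)) ?G"
    unfolding subalgebra_def
  proof (intro conjI subsetI)
    show "space ?G = space (P (Some x))"
      by (simp add: space_pre_sigma space_P[OF x'])
    fix A assume "A \<in> sets ?G"
    from sets_pre_sigmaD[OF st this, of s] show "A \<in> sets (P (Some x))"
      using sets_F[of s] by (auto simp: sets_P[OF x'])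
  qed
  interpret finite_measure_subalgebra "P (Some x)" ?G
    by unfold_locales (rule sub)
  have ev: "alive r \<in> events" for r
    using alive_in_sets by (simp add: sets_P[OF x'])
  let ?f = "indicator (alive (s + t)) :: 'w \<Rightarrow> real"
  have int: "integrable (P (Some x)) ?f"
    using ev by (intro integrable_real_indicator) (auto simp: emeasure_eq_measure)
  have "AE \<omega> in P (Some x). real_cond_exp (P (Some x)) ?G ?f \<omega> = measure (P (X s \<omega>)) (alive t)"
    using strong_markov[OF x' st range_Some_in_cemetery_borel, of t] by (simp add: alive_def)
  then have "AE \<omega> in P (Some x). indicator (alive s) \<omega> \<le> real_cond_exp (P (Some x)) ?G ?f \<omega>"
    using conservative
  proof eventually_elim
    case (elim \<omega>)
    show ?case
      using elim by (auto simp: alive_def survival_def split: split_indicator)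
  qed
  then have "(LINT \<omega>|P (Some x). indicator (alive s) \<omega>) \<le> (LINT \<omega>|P (Some x). real_cond_exp (P (Some x)) ?G ?f \<omega>)"
    using ev by (intro integral_mono_AE real_cond_exp_int(1)[OF int] integrable_real_indicator) (auto simp: emeasure_eq_measure)
  also have "\<dots> = (LINT \<omega>|P (Some x). ?f \<omega>)"
    by (rule real_cond_exp_int(2)[OF int])
  finally show ?thesis
    using ev by (simp add: survival_def)
qed

lemma lifetime_eq_top_iff:
  assumes "\<omega> \<in> space \<Omega>"
  shows "lifetime X \<omega> = \<infinity> \<longleftrightarrow> (\<forall>n. \<omega> \<in> alive (of_nat n))"
proof
  assume inf: "lifetime X \<omega> = \<infinity>"
  show "\<forall>n. \<omega> \<in> alive (of_nat n)"
  proof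
    fix n
    have "X (of_nat n) \<omega> \<noteq> None"
    proof
      assume "X (of_nat n) \<omega> = None"
      then have "lifetime X \<omega> \<le> of_nat n"
        unfolding lifetime_def by (intro Inf_lower) simp
      with inf show False
        by (simp add: top_unique)
    qed
    with assms show "\<omega> \<in> alive (of_nat n)"
      by (auto simp: alive_def)
  qed
next
  assume alive: "\<forall>n. \<omega> \<in> alive (of_nat n)"
  show "lifetime X \<omega> = \<infinity>"
  proof (rule ccontr)
    assume "lifetime X \<omega> \<noteq> \<infinity>"
    then obtain n where "lifetime X \<omega> < of_nat n"
      using ennreal_Ex_less_of_nat[of "lifetime X \<omega>"] by (auto simp: less_top)
    then have "X (of_nat n) \<omega> = None"
      by (intro absorbed[OF assms]) (rule less_imp_le)
    moreover have "X (of_nat n) \<omega> \<in> range Some"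
      using alive by (simp add: alive_def)
    ultimately show False
      by auto
  qed
qed

lemma lifetime_infinite_if_survival:
  assumes x: "x \<in> S" and surv: "\<And>t. survival (ennreal t) x = 1"
  shows "\<P>(\<omega> in P (Some x). lifetime X \<omega> = \<infinity>) = 1"
proof -
  have x': "Some x \<in> with_cemetery S"
    using x by simp
  interpret prob_space "P (Some x)"
    using x' by (rule prob_space_P)
  have ev: "alive r \<in> events" for r
    using alive_in_sets by (simp add: sets_P[OF x'])
  have "AE \<omega> in P (Some x). \<omega> \<in> alive (of_nat n)" for n
    using surv[of "real n"] ev by (simp add: AE_in_set_eq_1 survival_def ennreal_of_nat_eq_real_of_nat)
  then have "AE \<omega> in P (Some x). \<omega> \<in> (\<Inter>n. alive (of_nat n))"
    by (simp add: AE_all_countable)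
  then have "prob (\<Inter>n. alive (of_nat n)) = 1"
    using ev by (subst AE_in_set_eq_1[symmetric]) auto
  also have "(\<Inter>n. alive (of_nat n)) = {\<omega> \<in> space (P (Some x)). lifetime X \<omega> = \<infinity>}"
    using lifetime_eq_top_iff by (auto simp: space_P[OF x'] alive_def)
  finally show ?thesis .
qed

end

section \<open>Conservativeness\<close>

text \<open>The survival probability, set to $1$ on a Borel null set that contains $N$, satisfies the hypotheses
  of \<open>semigroup_conservative\<close>, because $E^x \phi_R(X_t)$ is at most the probability of being alive.\<close>
lemma (in hunt_process) survival_eq_1_AE:
  assumes J: "jump_kernel_second_moment J M"
    and assoc: "associated_process J N P X" and S: "S = - N"
    and null: "AE x in lborel. x \<notin> N" and t: "0 < t"
  shows "AE x in lborel. x \<in> S \<longrightarrow> survival (ennreal t) x = 1"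
proof -
  interpret jump_kernel_second_moment J M by (rule J)
  obtain T where T: "form_semigroup J T"
    and XT: "\<And>f t. f \<in> L2 \<Longrightarrow> bounded (range f) \<Longrightarrow> 0 < t \<Longrightarrow>
      AE x in lborel. x \<notin> N \<longrightarrow> (LINT \<omega>|P (Some x). case_option 0 f (X (ennreal t) \<omega>)) = T t f x"
    using assoc unfolding associated_process_def by blast
  obtain Z where Z: "N \<subseteq> Z" "Z \<in> null_sets lborel"
    using null by (auto simp: eventually_ae_filter)
  have [measurable]: "Z \<in> sets borel"
    using Z(2) by auto
  define h where "h s x = (if x \<in> Z then 1 else survival (ennreal s) x)" for s x
  have "AE x in lborel. h t x = 1"
  proof (rule semigroup_conservative[OF T])
    show "h s \<in> borel_measurable borel" for s
    proof -
      have "survival (ennreal s) \<in> borel_measurable (restrict_space borel {x. x \<notin> Z})"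
        by (rule measurable_restrict_mono[OF survival_measurable]) (use Z(1) S in auto)
      then show ?thesis
        unfolding h_def[abs_def] by (subst measurable_If_restrict_space_iff) auto
    qed
    show "0 \<le> h s x" "h s x \<le> 1" for s x
      using survival_le_1[of x] Z(1) S by (auto simp: h_def survival_def)
    show "h s' x \<le> h s x" if "0 < s" "s \<le> s'" for s s' x
      using that survival_antimono[of "ennreal s" "ennreal s'" x] Z(1) S by (auto simp: h_def ennreal_leI)
    show "AE x in lborel. T s (cutoff R) x \<le> h s x" if s: "0 < s" and R: "0 < R" for s R
    proof -
      have "bounded (range (cutoff R :: 'a \<Rightarrow> real))"
        using cutoff_bounds[where 'a='a] by (intro boundedI[of _ 1]) (auto simp: abs_of_nonneg)
      from XT[OF C1_in_L2[OF cutoff_C1[OF R]] this s] AE_not_in[OF Z(2)]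
      show ?thesis
      proof eventually_elim
        case (elim x)
        then have x: "x \<notin> N" "Some x \<in> with_cemetery S"
          using Z(1) S by auto
        interpret prob_space "P (Some x)"
          by (rule prob_space_P[OF x(2)])
        have ev: "alive (ennreal s) \<in> events"
          using alive_in_sets by (simp add: sets_P[OF x(2)])
        have "T s (cutoff R) x = (LINT \<omega>|P (Some x). case_option 0 (cutoff R) (X (ennreal s) \<omega>))"
          using elim x by simp
        also have "\<dots> \<le> (LINT \<omega>|P (Some x). indicator (alive (ennreal s)) \<omega>)"
        proof (rule integral_mono')
          show "integrable (P (Some x)) (indicator (alive (ennreal s)) :: _ \<Rightarrow> real)"
            using ev by (intro integrable_real_indicator) (auto simp: emeasure_eq_measure)
          fix \<omega> assume "\<omega> \<in> space (P (Some x))"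
          then show "case_option 0 (cutoff R) (X (ennreal s) \<omega>) \<le> indicator (alive (ennreal s)) \<omega>"
            by (auto simp: alive_def space_P[OF x(2)] cutoff_bounds split: option.split split_indicator)
        qed simp
        also have "\<dots> = h s x"
          using ev elim by (simp add: h_def survival_def)
        finally show ?case .
      qed
    qed
  qed (rule t)
  then show ?thesis
    using AE_not_in[OF Z(2)] by eventually_elim (simp add: h_def)
qed

text \<open>The density of the law at a small time $s$ excludes the null set of starting points from which
  survival may be uncertain, so the probability of being alive at time $t$ is at least that at
  time $s$; then $s \to 0$.\<close>
lemma (in hunt_process) survival_eq_1:
  assumes J: "jump_kernel_second_moment J M"
    and assoc: "associated_process J N P X" and S: "S = - N"
    and exc: "properly_exceptional J N P X"
    and dens: "transition_density N P X p"
    and x: "x \<in> S"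
  shows "survival (ennreal t) x = 1"
proof -
  have x': "Some x \<in> with_cemetery S"
    using x by simp
  have "capacity J N = 0"
    using exc by (simp add: properly_exceptional_def)
  then have null: "AE x in lborel. x \<notin> N"
    by (rule capacity_zero_imp_null)
  have step: "survival (ennreal s) x \<le> survival (ennreal t) x" if s: "0 < s" for s
  proof -
    \<comment> \<open>The almost everywhere statement needs a positive time, and survival up to a later time suffices.\<close>
    define r where "r = max t 1"
    have r: "0 < r" "t \<le> r"
      by (auto simp: r_def)
    obtain Z where Z: "{y. \<not> (y \<in> S \<longrightarrow> survival (ennreal r) y = 1)} \<subseteq> Z" "Z \<in> null_sets lborel"
      using survival_eq_1_AE[OF J assoc S null r(1)] by (auto simp: eventually_ae_filter)
    have "emeasure (P (Some x)) {\<omega> \<in> space (P (Some x)). X (ennreal s) \<omega> \<in> Some ` Z}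
        = (\<integral>\<^sup>+y\<in>Z. ennreal (p s x y) \<partial>lborel)"
      using dens s x S Z(2) by (auto simp: transition_density_def null_sets_def)
    also have "\<dots> = (\<integral>\<^sup>+(y::'a). 0 \<partial>lborel)"
      by (rule nn_integral_cong_AE, use AE_not_in[OF Z(2)] in eventually_elim) simp
    finally have "emeasure (P (Some x)) {\<omega> \<in> space (P (Some x)). X (ennreal s) \<omega> \<in> Some ` Z} = 0"
      by simp
    moreover have "{\<omega> \<in> space (P (Some x)). X (ennreal s) \<omega> \<in> Some ` Z} \<in> sets (P (Some x))"
    proof -
      have "Z \<in> sets borel"
        using Z(2) by auto
      then have "Some ` Z \<in> sets cemetery_borel"
        by (rule image_Some_in_cemetery_borel)
      from measurable_sets[OF adapted[of "ennreal s"] this]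
      have "X (ennreal s) -` (Some ` Z) \<inter> space \<Omega> \<in> sets \<Omega>"
        using sets_F by (auto simp: space_F)
      also have "X (ennreal s) -` (Some ` Z) \<inter> space \<Omega> = {\<omega> \<in> space \<Omega>. X (ennreal s) \<omega> \<in> Some ` Z}"
        by auto
      finally show ?thesis
        by (simp add: space_P[OF x'] sets_P[OF x'])
    qed
    ultimately have "AE \<omega> in P (Some x). X (ennreal s) \<omega> \<notin> Some ` Z"
      by (intro AE_I[where N="{\<omega> \<in> space (P (Some x)). X (ennreal s) \<omega> \<in> Some ` Z}"]) auto
    moreover have "AE \<omega> in P (Some x). \<forall>t<lifetime X \<omega>. X t \<omega> \<in> Some ` S"
      using exc x S unfolding properly_exceptional_def by (auto elim!: eventually_mono)
    ultimately have "AE \<omega> in P (Some x). X (ennreal s) \<omega> = None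
        \<or> (\<exists>y. X (ennreal s) \<omega> = Some y \<and> survival (ennreal r) y = 1)"
      using AE_space
    proof eventually_elim
      case (elim \<omega>)
      show ?case
      proof (cases "X (ennreal s) \<omega>")
        case (Some y)
        have "ennreal s < lifetime X \<omega>"
        proof (rule ccontr)
          assume "\<not> ennreal s < lifetime X \<omega>"
          with absorbed[of \<omega> "ennreal s"] elim(3) Some show False
            by (simp add: space_P[OF x'] not_less)
        qed
        with elim(2) Some have "y \<in> S"
          by auto
        moreover have "y \<notin> Z"
          using elim(1) Some by auto
        ultimately show ?thesis
          using Z(1) Some by auto
      qed simp
    qed
    then have "survival (ennreal s) x \<le> survival (ennreal s + ennreal r) x"
      by (rule survival_markov[OF x])
    also have "\<dots> \<le> survival (ennreal t) x"
      using r by (intro survival_antimono x) (auto intro: order_trans[OF ennreal_leI] simp: add_increasing)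
    finally show ?thesis .
  qed
  have "1 \<le> survival (ennreal t) x"
    by (rule LIMSEQ_le_const2[OF survival_small_times[OF x]]) (use step in auto)
  with survival_le_1[OF x] show ?thesis
    by (intro antisym)
qed

theorem theorem2p10:
  fixes J :: "real ^ 'n \<Rightarrow> real ^ 'n \<Rightarrow> real"
    and \<alpha> \<beta> \<kappa>\<^sub>1 \<kappa>\<^sub>2 :: real
    and N :: "(real ^ 'n) set"
    and \<Omega> :: "'w measure"
    and F :: "ennreal \<Rightarrow> 'w measure"
    and P :: "(real ^ 'n) option \<Rightarrow> 'w measure"
    and X :: "ennreal \<Rightarrow> 'w \<Rightarrow> (real ^ 'n) option"
    and \<theta> :: "ennreal \<Rightarrow> 'w \<Rightarrow> 'w"
    and p :: "real \<Rightarrow> real ^ 'n \<Rightarrow> real ^ 'n \<Rightarrow> real"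
  assumes "jump_kernel \<alpha> \<beta> \<kappa>\<^sub>1 \<kappa>\<^sub>2 J"
    and "hunt_process \<Omega> F (- N) P X \<theta>"
    and "associated_process J N P X"
    and "properly_exceptional J N P X"
    and "transition_density N P X p"
    and "\<forall>t>0. \<forall>x\<in>- N. \<forall>y\<in>- N. p t x y = p t y x"
    and "\<forall>t>0. \<forall>y\<in>- N. quasi_continuous_off J N (\<lambda>x. p t x y)"
    and "\<exists>C\<^sub>1>0. \<exists>C\<^sub>2>0. \<forall>t>0. \<forall>x\<in>- N. \<forall>y\<in>- N.
           p t x y \<le> C\<^sub>1 * t powr (- real CARD('n) / \<alpha>) * exp (C\<^sub>2 * t)"
  shows "\<forall>x\<in>- N. \<P>(\<omega> in P (Some x). lifetime X \<omega> = \<infinity>) = 1"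
proof
  fix x assume x: "x \<in> - N"
  interpret hunt_process \<Omega> F "- N" P X \<theta>
    by (rule assms(2))
  obtain M where J: "jump_kernel_second_moment J M"
    using jump_kernel_second_momentI[OF assms(1)] by blast
  show "\<P>(\<omega> in P (Some x). lifetime X \<omega> = \<infinity>) = 1"
    by (intro lifetime_infinite_if_survival x survival_eq_1[OF J assms(3) refl assms(4,5)])
qed

end
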